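(* Fix $N$. (i) There is a coupling of diffusive deposition $(\sigma(t))_{t\ge0}$ and Pólya's urn $(\eta(t))_{t\ge0}$ with $N$ colours, both started from $(0,\dots,0)$, such that $\sigma(t)\succ\eta(t)$ for all $t\ge0$; the same holds with ballistic deposition in place of diffusive deposition. (ii) There is a coupling of Pólya's urn $(\eta(t))$ and random allocation $(\xi(t))$ with $N$ colours, both started from $(0,\dots,0)$, such that $\eta(t)\succ\xi(t)$ for all $t\ge0$. That is, both deposition models are more monopolistic than Pólya's urn, which is more monopolistic than random allocation.
   Context: Deposition models: for $N\ge2$, $G_N=\{1,\dots,N\}$, a configuration $\sigma\in\mathbb N^N$ gives column heights; given $\sigma$, an explorer is a walk $(X_n,Z_n)_{n\ge0}$ with $(X_n)$ i.i.d. uniform on $G_N$, $Z_0=\max_i\sigma_i+1$, and increments $Z_{n+1}-Z_n$ i.i.d. uniform on $\{-1,1\}$ (diffusive deposition) or identically $-1$ (ballistic deposition); with $n^*=\inf\{n:Z_n\le\sigma_{X_n}\}$, the configuration becomes $\sigma+e_{X_{n^*}}$. Explorers are sent successively and independently; $\sigma(t)$ is the configuration after $t$ explorers. Pólya's urn with $N$ colours: a process $\eta(t)\in\mathbb N^N$ which at each step increases coordinate $i$ by one with probability $(\eta_i+1)/(|\eta|+N)$, where $|\eta|=\sum_j\eta_j$. Random allocation: at each step a coordinate chosen uniformly in $G_N$ is increased by one. Order: for $\sigma\in\mathbb N^N$ let $\bar\sigma$ be its nonincreasing rearrangement. For $\sigma,\eta\in\mathbb N^N$ with $|\sigma|=|\eta|$,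 write $\sigma\succ\eta$ (equivalently $\eta\prec\sigma$; "$\sigma$ is more monopolistic than $\eta$") if $\sum_{i=1}^k\bar\sigma_i\ge\sum_{i=1}^k\bar\eta_i$ for every $k=1,\dots,N$. *)

theory Defs
  imports "HOL-Probability.Probability"
begin

text \<open>Configurations in N^N are lists of length N, columns indexed by 0..N-1.\<close>

definition incr :: "nat list \<Rightarrow> nat \<Rightarrow> nat list" where
  "incr s i = s[i := s ! i + 1]"

definition explorer_result :: "nat list \<Rightarrow> nat stream \<Rightarrow> int stream \<Rightarrow> nat list" where
  "explorer_result s xs ds =
     (let Z = (\<lambda>n. int (Max (set s)) + 1 + (\<Sum>k<n. ds !! k));
          hit = (\<lambda>n. Z n \<le> int (s ! (xs !! n)))
      in if (\<exists>n. hit n) then incr s (xs !! (LEAST n. hit n)) else s)"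

definition deposition_step :: "nat \<Rightarrow> int pmf \<Rightarrow> nat list \<Rightarrow> nat list measure" where
  "deposition_step N inc s =
     distr (stream_space (measure_pmf (pmf_of_set {0..<N}))
              \<Otimes>\<^sub>M stream_space (measure_pmf inc))
           (count_space UNIV) (\<lambda>(xs, ds). explorer_result s xs ds)"

definition diffusive_step :: "nat \<Rightarrow> nat list \<Rightarrow> nat list measure" where
  "diffusive_step N = deposition_step N (pmf_of_set {-1, 1})"

definition ballistic_step :: "nat \<Rightarrow> nat list \<Rightarrow> nat list measure" where
  "ballistic_step N = deposition_step N (return_pmf (-1))"

text \<open>Polya urn: colour i chosen with probability (eta_i + 1)/(|eta| + N).\<close>
definition polya_step :: "nat \<Rightarrow> nat list \<Rightarrow> nat list measure" where
  "polya_step N e = measure_pmf (map_pmf (incr e)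
      (pmf_of_multiset (mset (concat (map (\<lambda>i. replicate (e ! i + 1) i) [0..<N])))))"

definition allocation_step :: "nat \<Rightarrow> nat list \<Rightarrow> nat list measure" where
  "allocation_step N e = measure_pmf (map_pmf (incr e) (pmf_of_set {0..<N}))"

primrec chain_law :: "('a \<Rightarrow> 'a measure) \<Rightarrow> 'a \<Rightarrow> nat \<Rightarrow> 'a list measure" where
  "chain_law K x0 0 = return (count_space UNIV) [x0]"
| "chain_law K x0 (Suc t) =
     Giry_Monad.bind (chain_law K x0 t)
       (\<lambda>xs. distr (K (last xs)) (count_space UNIV) (\<lambda>y. xs @ [y]))"

definition more_monopolistic :: "nat list \<Rightarrow> nat list \<Rightarrow> bool" where
  "more_monopolistic s e \<longleftrightarrow> length s = length e \<and> sum_list s = sum_list e \<and>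
     (\<forall>k\<in>{1..length s}. sum_list (take k (rev (sort e))) \<le> sum_list (take k (rev (sort s))))"

definition coupling_dominates ::
  "(nat list \<Rightarrow> nat list measure) \<Rightarrow> nat list \<Rightarrow> (nat list \<Rightarrow> nat list measure) \<Rightarrow> nat list \<Rightarrow> bool" where
  "coupling_dominates K1 x1 K2 x2 \<longleftrightarrow>
     (\<exists>M :: ((nat \<Rightarrow> nat list) \<times> (nat \<Rightarrow> nat list)) measure.
        prob_space M \<and>
        (\<forall>t. (\<lambda>\<omega>. map (fst \<omega>) [0..<Suc t]) \<in> measurable M (count_space UNIV) \<and>
             distr M (count_space UNIV) (\<lambda>\<omega>. map (fst \<omega>) [0..<Suc t]) = chain_law K1 x1 t) \<and>
        (\<forall>t. (\<lambda>\<omega>. map (snd \<omega>) [0..<Suc t]) \<in> measurable M (count_space UNIV) \<and>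
             distr M (count_space UNIV) (\<lambda>\<omega>. map (snd \<omega>) [0..<Suc t]) = chain_law K2 x2 t) \<and>
        (AE \<omega> in M. \<forall>t. more_monopolistic (fst \<omega> t) (snd \<omega> t)))"

end

theory Submission
  imports Defs
begin

text \<open>
  Each of the three processes adds a unit to a random column, and the columns are ranked by decreasing
  height. If \<open>s\<close> dominates \<open>e\<close>, and a unit is added to the column of rank \<open>i\<close> in \<open>s\<close> and of rank \<open>j \<ge> i\<close> in
  \<open>e\<close>, then domination persists. Choosing both ranks as quantiles of one uniform variable, it suffices that
  the top \<open>k\<close> columns are at least as likely to be chosen in the dominating process. For Polya's urn this
  probability is \<open>(S\<^sub>k + k) / (S\<^sub>N + N)\<close>, where \<open>S\<^sub>k\<close> is the sum of the \<open>k\<close> largest heights; it is monotone in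
  the order and at least \<open>k / N\<close>.

  For deposition, let \<open>a\<^sub>z\<close> be the number of columns of height at least \<open>z\<close>. An explorer at height \<open>z\<close> stops with
  probability \<open>a\<^sub>z / N\<close>, uniformly on those columns, so the height at which it stops has a law proportional to
  \<open>g\<^sub>z a\<^sub>z\<close>, where \<open>g\<close> is the Green function of the killed walk. Polya's urn is the case of constant \<open>g\<close>.
  Since \<open>g\<close> is nondecreasing, Chebyshev's sum inequality favours the high columns.
\<close>

section \<open>Markov chains driven by uniform variables\<close>

primrec orbit :: "('a \<Rightarrow> real \<Rightarrow> 'a) \<Rightarrow> 'a \<Rightarrow> real stream \<Rightarrow> nat \<Rightarrow> 'a" where
  "orbit f x u 0 = x"
| "orbit f x u (Suc n) = orbit f (f x (shd u)) (stl u) n"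

text \<open>The recursion peels off the first step, as the head of a stream is split off;
  \<open>chain_law\<close> appends the last step instead.\<close>

primrec pmf_chain :: "('a \<Rightarrow> 'a pmf) \<Rightarrow> 'a \<Rightarrow> nat \<Rightarrow> 'a list pmf" where
  "pmf_chain k x 0 = return_pmf [x]"
| "pmf_chain k x (Suc t) = bind_pmf (k x) (\<lambda>y. map_pmf ((#) x) (pmf_chain k y t))"

lemma pmf_chain_nonempty: "xs \<in> set_pmf (pmf_chain k x t) \<Longrightarrow> xs \<noteq> []"
  by (cases t) auto

lemma pmf_chain_Suc_back:
  "pmf_chain k x (Suc t) =
     bind_pmf (pmf_chain k x t) (\<lambda>xs. map_pmf (\<lambda>y. xs @ [y]) (k (last xs)))"
proof (induction t arbitrary: x)
  case 0
  show ?case by (simp add: bind_return_pmf map_pmf_def)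
next
  case (Suc t)
  have "pmf_chain k x (Suc (Suc t)) =
    bind_pmf (k x) (\<lambda>y. map_pmf ((#) x) (pmf_chain k y (Suc t)))"
    by (rule pmf_chain.simps)
  also have "\<dots> = bind_pmf (k x) (\<lambda>y. bind_pmf (pmf_chain k y t)
      (\<lambda>xs. map_pmf (\<lambda>z. (x # xs) @ [z]) (k (last xs))))"
    unfolding Suc.IH by (simp add: map_bind_pmf pmf.map_comp o_def)
  also have "\<dots> = bind_pmf (k x) (\<lambda>y. bind_pmf (pmf_chain k y t)
      (\<lambda>xs. map_pmf (\<lambda>z. (x # xs) @ [z]) (k (last (x # xs)))))"
    by (intro bind_pmf_cong refl) (auto dest: pmf_chain_nonempty)
  also have "\<dots> = bind_pmf (pmf_chain k x (Suc t)) (\<lambda>xs. map_pmf (\<lambda>y. xs @ [y]) (k (last xs)))"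
    by (simp add: bind_assoc_pmf bind_map_pmf)
  finally show ?case .
qed

lemma chain_law_measure_pmf: "chain_law (\<lambda>s. measure_pmf (k s)) x t = measure_pmf (pmf_chain k x t)"
proof (induction t)
  case 0
  show ?case by (simp add: return_pmf.rep_eq)
next
  case (Suc t)
  show ?case
    unfolding chain_law.simps Suc.IH pmf_chain_Suc_back measure_pmf_bind map_pmf_rep_eq
    by (rule refl)
qed

lemma measurable_orbit:
  fixes f :: "'a::countable \<Rightarrow> real \<Rightarrow> 'a"
  assumes [measurable]: "\<And>x. f x \<in> measurable U (count_space UNIV)"
  shows "(\<lambda>u. orbit f x u n) \<in> measurable (stream_space U) (count_space UNIV)"
proof (induction n arbitrary: x)
  case 0
  show ?case by simp
next
  case (Suc n)
  note Suc.IH[measurable]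
  have "(\<lambda>u. orbit f (f x (shd u)) (stl u) n) \<in> measurable (stream_space U) (count_space UNIV)"
    by (rule measurable_compose_countable[where g="\<lambda>u. f x (shd u)"]) measurable
  then show ?case by simp
qed

lemma measurable_map_upt:
  fixes g :: "nat \<Rightarrow> 'b \<Rightarrow> 'a::countable"
  assumes [measurable]: "\<And>n. g n \<in> measurable M (count_space UNIV)"
  shows "(\<lambda>u. map (\<lambda>n. g n u) xs) \<in> measurable M (count_space UNIV)"
proof (induction xs)
  case Nil
  show ?case by simp
next
  case (Cons n xs)
  have "(\<lambda>u. g n u # map (\<lambda>n. g n u) xs) \<in> measurable M (count_space UNIV)"
    by (rule measurable_compose_countable[OF _ Cons.IH]) measurable
  then show ?case by simp
qed

text \<open>The tail of an i.i.d. stream is independent of its head and has the law of the whole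
  stream, hence the induction over \<open>t\<close> with \<open>x\<close> arbitrary. The invariant
  \<open>P\<close> will be having length \<open>N\<close>.\<close>

lemma distr_orbit:
  fixes f :: "'a::countable \<Rightarrow> real \<Rightarrow> 'a"
  assumes U: "prob_space U"
    and f[measurable]: "\<And>x. f x \<in> measurable U (count_space UNIV)"
    and inv: "\<And>x u. P x \<Longrightarrow> P (f x u)"
    and k: "\<And>x. P x \<Longrightarrow> distr U (count_space UNIV) (f x) = measure_pmf (k x)"
  shows "P x \<Longrightarrow> distr (stream_space U) (count_space UNIV) (\<lambda>u. map (orbit f x u) [0..<Suc t]) =
    measure_pmf (pmf_chain k x t)"
proof (induction t arbitrary: x)
  case 0
  interpret S: prob_space "stream_space U"
    using U by (rule prob_space.prob_space_stream_space)
  show ?case by (simp add: return_pmf.rep_eq S.distr_const)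
next
  case (Suc t)
  interpret U: prob_space U by fact
  note [measurable] = measurable_map_upt[OF measurable_orbit[OF f]]
  have split: "map (orbit f x (v ## u)) [0..<Suc (Suc t)] = x # map (orbit f (f x v) u) [0..<Suc t]" for v u
    by (simp add: upt_conv_Cons map_Suc_upt[symmetric] del: upt_Suc)
  show ?case
  proof (rule measure_eqI)
    fix A :: "'a list set"
    let ?S = "stream_space U"
    have "emeasure (distr ?S (count_space UNIV) (\<lambda>u. map (orbit f x u) [0..<Suc (Suc t)])) A
      = emeasure ?S {u\<in>space ?S. map (orbit f x u) [0..<Suc (Suc t)] \<in> A}"
      by (subst emeasure_distr) (auto intro!: arg_cong2[where f=emeasure] simp del: upt_Suc)
    also have "\<dots> = (\<integral>\<^sup>+v. emeasure ?S {u\<in>space ?S.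
       v ## u \<in> {u\<in>space ?S. map (orbit f x u) [0..<Suc (Suc t)] \<in> A}} \<partial>U)"
      by (rule U.emeasure_stream_space) measurable
    also have "\<dots> = (\<integral>\<^sup>+v. emeasure (pmf_chain k (f x v) t) ((#) x -` A) \<partial>U)"
    proof (rule nn_integral_cong)
      fix v assume v: "v \<in> space U"
      have "emeasure (pmf_chain k (f x v) t) ((#) x -` A) =
        emeasure (distr ?S (count_space UNIV) (\<lambda>u. map (orbit f (f x v) u) [0..<Suc t])) ((#) x -` A)"
        using Suc by (simp add: inv del: upt_Suc)
      also have "\<dots> = emeasure ?S {u\<in>space ?S. x # map (orbit f (f x v) u) [0..<Suc t] \<in> A}"
        by (subst emeasure_distr) (auto intro!: arg_cong2[where f=emeasure] simp del: upt_Suc)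
      also have "{u\<in>space ?S. x # map (orbit f (f x v) u) [0..<Suc t] \<in> A} =
        {u\<in>space ?S. v ## u \<in> {u\<in>space ?S. map (orbit f x u) [0..<Suc (Suc t)] \<in> A}}"
        using v unfolding mem_Collect_eq split by (auto simp: space_stream_space simp del: upt_Suc)
      finally show "emeasure ?S {u\<in>space ?S.
          v ## u \<in> {u\<in>space ?S. map (orbit f x u) [0..<Suc (Suc t)] \<in> A}} =
        emeasure (pmf_chain k (f x v) t) ((#) x -` A)" by simp
    qed
    also have "\<dots> = (\<integral>\<^sup>+y. emeasure (pmf_chain k y t) ((#) x -` A) \<partial>distr U (count_space UNIV) (f x))"
      by (subst nn_integral_distr) auto
    also have "\<dots> = emeasure (pmf_chain k x (Suc t)) A"
      using Suc.prems by (simp add: k emeasure_bind_pmf)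
    finally show "emeasure (distr ?S (count_space UNIV) (\<lambda>u. map (orbit f x u) [0..<Suc (Suc t)])) A =
      emeasure (pmf_chain k x (Suc t)) A" .
  qed simp
qed

lemma orbit_rel:
  assumes "\<And>s e u. R s e \<Longrightarrow> R (f s u) (g e u)" "R s e"
  shows "R (orbit f s u n) (orbit g e u n)"
  using assms(2) by (induction n arbitrary: s e u) (auto intro: assms(1))

text \<open>One stream drives both chains. The relation \<open>R\<close> may be stronger than the
  order; being preserved for every \<open>u\<close>, it holds surely along the two
  trajectories.\<close>

lemma coupling_dominatesI:
  fixes f g :: "nat list \<Rightarrow> real \<Rightarrow> nat list"
  assumes U: "prob_space U"
    and f: "\<And>x. f x \<in> measurable U (count_space UNIV)"
    and g: "\<And>x. g x \<in> measurable U (count_space UNIV)"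
    and inv: "\<And>x u. P x \<Longrightarrow> P (f x u)" "\<And>x u. P x \<Longrightarrow> P (g x u)"
    and k: "\<And>x. P x \<Longrightarrow> distr U (count_space UNIV) (f x) = measure_pmf (k x)"
    and l: "\<And>x. P x \<Longrightarrow> distr U (count_space UNIV) (g x) = measure_pmf (l x)"
    and R: "\<And>s e u. R s e \<Longrightarrow> R (f s u) (g e u)" "\<And>s e. R s e \<Longrightarrow> more_monopolistic s e"
    and init: "P x" "P y" "R x y"
  shows "coupling_dominates (\<lambda>s. measure_pmf (k s)) x (\<lambda>s. measure_pmf (l s)) y"
proof -
  let ?S = "stream_space U"
  let ?F = "\<lambda>u. (orbit f x u, orbit g y u)"
  let ?\<Pi> = "PiM UNIV (\<lambda>_::nat. count_space (UNIV :: nat list set))"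
  define M where "M = distr ?S (?\<Pi> \<Otimes>\<^sub>M ?\<Pi>) ?F"
  interpret S: prob_space ?S
    using U by (rule prob_space.prob_space_stream_space)
  note [measurable] = measurable_orbit[OF f] measurable_orbit[OF g]
  have meas: "orbit h z \<in> measurable ?S ?\<Pi>" 
    if "\<And>n. (\<lambda>u. orbit h z u n) \<in> measurable ?S (count_space UNIV)" for h z
    using that by (intro measurable_PiM_single') auto
  have F[measurable]: "?F \<in> measurable ?S (?\<Pi> \<Otimes>\<^sub>M ?\<Pi>)"
    by (intro measurable_Pair meas) measurable
  have comp: "(\<lambda>h. h n) \<in> measurable ?\<Pi> (count_space UNIV)" for n
    by measurable
  have c1[measurable]: "(\<lambda>\<omega>. fst \<omega> n) \<in> measurable (?\<Pi> \<Otimes>\<^sub>M ?\<Pi>) (count_space UNIV)" for n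
    by (rule measurable_compose[OF measurable_fst comp])
  have c2[measurable]: "(\<lambda>\<omega>. snd \<omega> n) \<in> measurable (?\<Pi> \<Otimes>\<^sub>M ?\<Pi>) (count_space UNIV)" for n
    by (rule measurable_compose[OF measurable_snd comp])
  note m1 = measurable_map_upt[OF c1] and m2 = measurable_map_upt[OF c2]
  have rel: "R (orbit f x u n) (orbit g y u n)" for u n
    using R(1) init(3) by (rule orbit_rel)
  have "(\<lambda>\<omega>. (fst \<omega> t, snd \<omega> t)) \<in> measurable (?\<Pi> \<Otimes>\<^sub>M ?\<Pi>) (count_space UNIV)" for t
    by (rule measurable_compose_countable[where g="\<lambda>\<omega>. fst \<omega> t", OF _ c1])
      (rule measurable_compose[OF c2], simp)
  then have "(\<lambda>\<omega>. case_prod more_monopolistic (fst \<omega> t, snd \<omega> t)) \<in> 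
      measurable (?\<Pi> \<Otimes>\<^sub>M ?\<Pi>) (count_space UNIV)" for t
    by (rule measurable_compose) simp
  then have pred: "Measurable.pred (?\<Pi> \<Otimes>\<^sub>M ?\<Pi>) (\<lambda>\<omega>. more_monopolistic (fst \<omega> t) (snd \<omega> t))" for t
    by simp
  show ?thesis
    unfolding coupling_dominates_def
  proof (intro exI[of _ M] conjI allI)
    show "prob_space M"
      unfolding M_def by (rule S.prob_space_distr) measurable
    fix t
    show "(\<lambda>\<omega>. map (fst \<omega>) [0..<Suc t]) \<in> measurable M (count_space UNIV)"
      "(\<lambda>\<omega>. map (snd \<omega>) [0..<Suc t]) \<in> measurable M (count_space UNIV)"
      unfolding M_def using m1 m2 by (simp_all del: upt_Suc)
    show "distr M (count_space UNIV) (\<lambda>\<omega>. map (fst \<omega>) [0..<Suc t]) =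
        chain_law (\<lambda>s. measure_pmf (k s)) x t"
      unfolding M_def using distr_orbit[OF U f inv(1) k init(1)]
      by (subst distr_distr[OF m1 F]) (simp_all add: o_def chain_law_measure_pmf del: upt_Suc)
    show "distr M (count_space UNIV) (\<lambda>\<omega>. map (snd \<omega>) [0..<Suc t]) =
        chain_law (\<lambda>s. measure_pmf (l s)) y t"
      unfolding M_def using distr_orbit[OF U g inv(2) l init(2)]
      by (subst distr_distr[OF m2 F]) (simp_all add: o_def chain_law_measure_pmf del: upt_Suc)
  next
    show "AE \<omega> in M. \<forall>t. more_monopolistic (fst \<omega> t) (snd \<omega> t)"
      unfolding M_def AE_all_countable
    proof
      fix t
      show "AE \<omega> in distr ?S (?\<Pi> \<Otimes>\<^sub>M ?\<Pi>) ?F. more_monopolistic (fst \<omega> t) (snd \<omega> t)"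
        by (subst AE_distr_iff[OF F]) (use pred[of t] in \<open>simp_all add: pred_def R(2)[OF rel]\<close>)
    qed
  qed
qed

section \<open>Majorization and ranks\<close>

definition ranked :: "nat list \<Rightarrow> nat list" where
  "ranked s = rev (sort_key ((!) s) [0..<length s])"

definition top_columns :: "nat \<Rightarrow> nat list \<Rightarrow> nat set" where
  "top_columns k s = set (take k (ranked s))"

text \<open>The order is handled through the sums of \<open>(s\<^sub>i - c)\<^sup>+\<close> (truncated subtraction), which, unlike
  the partial sums of the rearrangement, need no sorting and change in a simple way under \<^const>\<open>incr\<close>.\<close>

definition excess :: "nat \<Rightarrow> nat list \<Rightarrow> nat" where
  "excess c s = (\<Sum>i<length s. s ! i - c)"

lemma length_ranked [simp]: "length (ranked s) = length s"
  by (simp add: ranked_def)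

lemma set_ranked [simp]: "set (ranked s) = {..<length s}"
  by (auto simp: ranked_def)

lemma distinct_ranked [simp]: "distinct (ranked s)"
  by (simp add: ranked_def)

lemma map_ranked: "map ((!) s) (ranked s) = rev (sort s)"
proof -
  have "map ((!) s) (sort_key ((!) s) [0..<length s]) = sort s"
  proof (rule properties_for_sort[symmetric])
    have "mset (map ((!) s) (sort_key ((!) s) [0..<length s])) = mset (map ((!) s) [0..<length s])"
      by simp
    then show "mset (map ((!) s) (sort_key ((!) s) [0..<length s])) = mset s"
      by (simp only: map_nth)
  qed simp
  then show ?thesis
    by (simp add: ranked_def rev_map[symmetric])
qed

lemma ranked_antimono:
  assumes "i \<le> j" "j < length s"
  shows "s ! (ranked s ! j) \<le> s ! (ranked s ! i)"
proof -
  have "sorted_wrt (\<ge>) (rev (sort s))"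
    by (simp add: sorted_wrt_rev)
  then have "rev (sort s) ! j \<le> rev (sort s) ! i"
    using assms by (cases "i = j") (auto simp: sorted_wrt_iff_nth_less)
  then show ?thesis
    using assms by (simp flip: map_ranked)
qed

lemma ranked_less: "i < length s \<Longrightarrow> ranked s ! i < length s"
  using nth_mem[of i "ranked s"] by simp

lemma top_columns_subset: "top_columns k s \<subseteq> {..<length s}"
  unfolding top_columns_def using set_take_subset[of k "ranked s"] by simp

lemma finite_top_columns [simp]: "finite (top_columns k s)"
  by (simp add: top_columns_def)

lemma card_top_columns: "k \<le> length s \<Longrightarrow> card (top_columns k s) = k"
  unfolding top_columns_def by (subst distinct_card) auto

lemma top_columns_length [simp]: "top_columns (length s) s = {..<length s}"
  by (simp add: top_columns_def)

lemma top_columns_image: "k \<le> length s \<Longrightarrow> top_columns k s = (!) (ranked s) ` {..<k}"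
  unfolding top_columns_def using nth_image[of k "ranked s"] by (simp add: lessThan_atLeast0)

lemma in_top_columns_iff: "k \<le> length s \<Longrightarrow> i \<in> top_columns k s \<longleftrightarrow> (\<exists>a<k. ranked s ! a = i)"
  by (auto simp: top_columns_image)

lemma top_columns_le:
  assumes "i \<in> top_columns k s" "j < length s" "j \<notin> top_columns k s"
  shows "s ! j \<le> s ! i"
proof -
  obtain b where b: "b < length s" "ranked s ! b = j"
    using assms(2) by (metis in_set_conv_nth length_ranked lessThan_iff set_ranked)
  obtain a where a: "a < k" "a < length s" "ranked s ! a = i"
    using assms(1) by (auto simp: top_columns_def in_set_conv_nth)
  have "k \<le> b"
    using assms(3) b by (metis in_set_conv_nth length_ranked length_take min_less_iff_conj not_le nth_take top_columns_def)
  then show ?thesis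
    using ranked_antimono[of a b s] a b by simp
qed

lemma sum_top: "sum_list (take k (rev (sort s))) = (\<Sum>i\<in>top_columns k s. s ! i)"
  by (simp add: top_columns_def map_ranked[symmetric] take_map sum_list_distinct_conv_sum_set)

text \<open>Every height is at most \<open>c\<close> plus its excess over \<open>c\<close>. Together
  with \<open>sum_top_excess\<close>, this makes the sum of the \<open>k\<close> largest heights the
  minimum over \<open>c\<close> of \<open>k * c + excess c e\<close>.\<close>

lemma sum_le_excess:
  assumes "T \<subseteq> {..<length e}"
  shows "(\<Sum>i\<in>T. e ! i) \<le> card T * c + excess c e"
proof -
  have "(\<Sum>i\<in>T. e ! i) \<le> (\<Sum>i\<in>T. c + (e ! i - c))"
    by (rule sum_mono) simp
  also have "\<dots> = card T * c + (\<Sum>i\<in>T. e ! i - c)"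
    by (simp add: sum.distrib)
  also have "(\<Sum>i\<in>T. e ! i - c) \<le> excess c e"
    unfolding excess_def using assms by (intro sum_mono2) auto
  finally show ?thesis by simp
qed

text \<open>The equality case: if \<open>c\<close> is the smallest height among the top columns,
  nothing is truncated on them, and the other columns have no excess.\<close>

lemma sum_top_excess:
  assumes "k < length s"
  shows "(\<Sum>i\<in>top_columns (Suc k) s. s ! i) = Suc k * s ! (ranked s ! k) + excess (s ! (ranked s ! k)) s"
proof -
  define c where "c = s ! (ranked s ! k)"
  have T: "c \<le> s ! i" if "i \<in> top_columns (Suc k) s" for i
    using that assms ranked_antimono[of _ k s] by (auto simp: top_columns_image c_def)
  have k: "ranked s ! k \<in> top_columns (Suc k) s"
    using assms by (auto simp: top_columns_image)
  have "excess c s = (\<Sum>i\<in>top_columns (Suc k) s. s ! i - c)"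
    unfolding excess_def
    by (intro sum.mono_neutral_right) (use top_columns_subset[of "Suc k" s] top_columns_le[OF k] in \<open>auto simp: c_def\<close>)
  then have "Suc k * c + excess c s = (\<Sum>i\<in>top_columns (Suc k) s. c + (s ! i - c))"
    using assms by (simp add: sum.distrib card_top_columns)
  also have "\<dots> = (\<Sum>i\<in>top_columns (Suc k) s. s ! i)"
    using T by (intro sum.cong) auto
  finally show ?thesis by (simp add: c_def)
qed

section \<open>Majorization through excesses and its preservation under increments\<close>

definition dominates :: "nat list \<Rightarrow> nat list \<Rightarrow> bool" where
  "dominates s e \<longleftrightarrow> length s = length e \<and> sum_list s = sum_list e \<and> (\<forall>c. excess c e \<le> excess c s)"

lemma dominates_sum_top:
  assumes "dominates s e" "k \<le> length s"
  shows "(\<Sum>i\<in>top_columns k e. e ! i) \<le> (\<Sum>i\<in>top_columns k s. s ! i)"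
proof (cases k)
  case 0
  then show ?thesis by (simp add: top_columns_def)
next
  case (Suc l)
  \<comment> \<open>This level attains the minimum for \<open>s\<close>, while for \<open>e\<close>
    it only gives an upper bound.\<close>
  let ?c = "s ! (ranked s ! l)"
  have k: "k \<le> length e"
    using assms by (simp add: dominates_def)
  have "(\<Sum>i\<in>top_columns k e. e ! i) \<le> k * ?c + excess ?c e"
    using sum_le_excess[OF top_columns_subset[of k e], of ?c] by (simp add: card_top_columns[OF k])
  also have "\<dots> \<le> k * ?c + excess ?c s"
    using assms by (simp add: dominates_def)
  also have "\<dots> = (\<Sum>i\<in>top_columns k s. s ! i)"
    using sum_top_excess[of l s] assms Suc by simp
  finally show ?thesis .
qed

lemma dominates_more_monopolistic: "dominates s e \<Longrightarrow> more_monopolistic s e"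
  using dominates_sum_top[of s e] by (auto simp: more_monopolistic_def sum_top dominates_def)

lemma length_incr [simp]: "length (incr s i) = length s"
  by (simp add: incr_def)

lemma sum_list_incr: "i < length s \<Longrightarrow> sum_list (incr s i) = Suc (sum_list s)"
  by (simp add: incr_def sum_list_update)

lemma excess_incr:
  assumes "i < length s"
  shows "excess c (incr s i) = excess c s + (if c \<le> s ! i then 1 else 0)"
proof -
  have "excess c (incr s i) = (\<Sum>j<length s. (s ! j - c) + (if j = i then (if c \<le> s ! i then 1 else 0) else 0))"
    unfolding excess_def by (rule sum.cong) (auto simp: incr_def nth_list_update)
  then show ?thesis
    using assms by (simp add: sum.distrib excess_def)
qed

lemma excess_Suc: "excess c s = excess (Suc c) s + card {i. i < length s \<and> Suc c \<le> s ! i}"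
proof -
  have "excess c s = (\<Sum>i<length s. (s ! i - Suc c) + (if Suc c \<le> s ! i then 1 else 0))"
    unfolding excess_def by (rule sum.cong) auto
  also have "\<dots> = excess (Suc c) s + card {i. i < length s \<and> Suc c \<le> s ! i}"
    by (simp add: sum.distrib excess_def sum.If_cases) (rule arg_cong[where f=card], auto)
  finally show ?thesis .
qed

text \<open>If the excesses over \<open>c\<close> agree, then \<open>s\<close> has at least as many columns of height at least \<open>c\<close> as
  \<open>e\<close>, so the column of the smaller rank in \<open>s\<close> reaches \<open>c\<close> whenever the chosen column of \<open>e\<close> does.\<close>

lemma dominates_incr:
  assumes "dominates s e" "i \<le> j" "j < length s"
  shows "dominates (incr s (ranked s ! i)) (incr e (ranked e ! j))"
proof -
  have len: "length e = length s" and tot: "sum_list s = sum_list e"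
    and ex: "excess c e \<le> excess c s" for c
    using assms(1) by (auto simp: dominates_def)
  let ?i = "ranked s ! i" and ?j = "ranked e ! j"
  have lt: "?i < length s" "?j < length e"
    using assms len ranked_less[of i s] ranked_less[of j e] by auto
  \<comment> \<open>The order could only be lost at a level where the excess of \<open>e\<close>
    grows and that of \<open>s\<close> does not.\<close>
  have key: "excess c e < excess c s" if c: "c \<le> e ! ?j" "\<not> c \<le> s ! ?i" for c
  proof (rule ccontr)
    assume "\<not> excess c e < excess c s"
    with ex[of c] have eq: "excess c e = excess c s" by simp
    \<comment> \<open>The chosen column of \<open>s\<close> lies below \<open>c\<close>, so
      \<open>c\<close> is positive. Equal excesses over \<open>c\<close> and ordered excesses over
      \<open>b\<close> compare the numbers of columns reaching \<open>c\<close>.\<close>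
    obtain b where b: "c = Suc b" using c by (cases c) auto
    have "top_columns (Suc j) e \<subseteq> {l. l < length e \<and> c \<le> e ! l}"
    proof
      fix l assume "l \<in> top_columns (Suc j) e"
      then obtain a where "a < Suc j" "ranked e ! a = l"
        using assms(3) len by (auto simp: in_top_columns_iff)
      then show "l \<in> {l. l < length e \<and> c \<le> e ! l}"
        using ranked_antimono[of a j e] ranked_less[of a e] assms(3) len c by auto
    qed
    from card_mono[OF _ this] have "Suc j \<le> card {l. l < length e \<and> c \<le> e ! l}"
      using assms len by (simp add: card_top_columns)
    also have "\<dots> \<le> card {l. l < length s \<and> c \<le> s ! l}"
      using ex[of b] eq unfolding excess_Suc[of b] b by simp
    \<comment> \<open>In \<open>s\<close> the columns of rank \<open>i\<close> or more lie below
      \<open>c\<close>. The counts then give \<open>Suc j\<close> \<le> \<open>i\<close>, against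
      \<open>i\<close> \<le> \<open>j\<close>.\<close>
    also have "{l. l < length s \<and> c \<le> s ! l} \<subseteq> top_columns i s"
    proof
      fix l assume "l \<in> {l. l < length s \<and> c \<le> s ! l}"
      then obtain a where a: "a < length s" "ranked s ! a = l" "c \<le> s ! l"
        by (metis (mono_tags) in_set_conv_nth length_ranked lessThan_iff mem_Collect_eq set_ranked)
      then have "a < i"
        using ranked_antimono[of i a s] c by (cases "a < i") auto
      then show "l \<in> top_columns i s"
        using a assms by (auto simp: top_columns_image)
    qed
    from card_mono[OF _ this] have "card {l. l < length s \<and> c \<le> s ! l} \<le> i"
      using assms by (simp add: card_top_columns)
    finally show False using assms by simp
  qed
  show ?thesis
    unfolding dominates_def using lt len tot key
    by (auto simp: sum_list_incr excess_incr Suc_le_eq less_Suc_eq_le intro: le_SucI ex)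
qed

section \<open>Quantile coupling\<close>

text \<open>Ranks start at 0. The disjunct \<open>N \<le> Suc k\<close> keeps the quantile below \<open>N\<close> for all real \<open>u\<close>, so that the
  coupling is monotone surely and not just for \<open>u\<close> in the unit interval.\<close>

definition quantile :: "nat \<Rightarrow> (nat \<Rightarrow> real) \<Rightarrow> real \<Rightarrow> nat" where
  "quantile N F u = (LEAST k. u < F k \<or> N \<le> Suc k)"

text \<open>A larger distribution function exceeds \<open>u\<close> earlier. From
  \<open>N - 1\<close> on the cap decides, so the comparison stops before it.\<close>

lemma quantile_mono:
  assumes "\<And>k. Suc k < N \<Longrightarrow> G k \<le> F k"
  shows "quantile N F u \<le> quantile N G u"
proof -
  have "u < G (quantile N G u) \<or> N \<le> Suc (quantile N G u)"
    unfolding quantile_def by (rule LeastI[of _ N]) simp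
  then show ?thesis
    unfolding quantile_def[of _ F] using assms[of "quantile N G u"]
    by (intro Least_le) force
qed

lemma quantile_cong: "(\<And>k. Suc k < N \<Longrightarrow> G k = F k) \<Longrightarrow> quantile N F u = quantile N G u"
  by (rule antisym; rule quantile_mono) auto

lemma quantile_less: "0 < N \<Longrightarrow> quantile N F u < N"
  unfolding quantile_def by (rule le_less_trans[OF Least_le[of _ "N - 1"]]) auto

lemma quantile_le_iff:
  assumes "mono F"
  shows "quantile N F u \<le> k \<longleftrightarrow> u < F k \<or> N \<le> Suc k"
proof
  have "u < F (quantile N F u) \<or> N \<le> Suc (quantile N F u)"
    unfolding quantile_def by (rule LeastI[of _ N]) simp
  moreover assume "quantile N F u \<le> k"
  ultimately show "u < F k \<or> N \<le> Suc k"
    using monoD[OF assms, of "quantile N F u" k] by auto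
qed (auto simp: quantile_def intro: Least_le)

section \<open>Sampling a column from a uniform variable\<close>

abbreviation uniform01 :: "real measure" where
  "uniform01 \<equiv> uniform_measure lborel {0..<1}"

lemma prob_space_uniform01: "prob_space uniform01"
  by (rule prob_space_uniform_measure) auto

lemma measure_uniform01: "0 \<le> a \<Longrightarrow> a \<le> 1 \<Longrightarrow> measure uniform01 {..<a} = a"
proof -
  assume a: "0 \<le> a" "a \<le> 1"
  then have "{0..<1} \<inter> {..<a} = {0..<a}"
    by auto
  then show ?thesis
    using a by (simp add: measure_uniform_measure)
qed

lemma measurable_quantile [measurable]: "quantile N F \<in> measurable uniform01 (count_space UNIV)"
  unfolding quantile_def by measurable

text \<open>The two distribution functions agree, and singletons are differences of initial
  segments. From \<open>N - 1\<close> on both equal 1, by the cap and by the support of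
  \<open>q\<close>.\<close>

lemma distr_quantile:
  assumes "set_pmf q \<subseteq> {..<N}"
  shows "distr uniform01 (count_space UNIV) (quantile N (\<lambda>k. measure q {..k})) = measure_pmf q"
proof -
  interpret U: prob_space uniform01 by (rule prob_space_uniform01)
  let ?X = "quantile N (\<lambda>k. measure q {..k})"
  let ?D = "distr uniform01 (count_space UNIV) ?X"
  interpret D: prob_space ?D by (rule U.prob_space_distr) simp
  have mono: "mono (\<lambda>k. measure q {..k})"
    by (intro monoI measure_pmf.finite_measure_mono) auto
  have cdf: "measure ?D {..k} = measure q {..k}" for k
  proof (cases "N \<le> Suc k")
    case True
    then have "measure q {..k} = 1"
      using assms by (subst measure_pmf.prob_eq_1) (auto simp: AE_measure_pmf_iff)
    moreover have "measure ?D {..k} = 1"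
      using True U.prob_space by (simp add: measure_distr quantile_le_iff[OF mono] vimage_def)
    ultimately show ?thesis by simp
  next
    case False
    have "?X -` {..k} = {..<measure q {..k}}"
      using False by (auto simp: quantile_le_iff[OF mono])
    then show ?thesis
      by (simp add: measure_distr measure_uniform01 del: measure_uniform_measure)
  qed
  show ?thesis
  proof (rule measure_eqI_countable[where A=UNIV])
    fix k :: nat
    have "measure ?D {k} = measure q {k}"
    proof (cases k)
      case 0
      then show ?thesis using cdf[of 0] by simp
    next
      case (Suc l)
      have "{k} = {..k} - {..l}" using Suc by auto
      then show ?thesis
        using Suc cdf[of k] cdf[of l]
        by (simp add: D.finite_measure_Diff measure_pmf.finite_measure_Diff)
    qed
    then show "emeasure ?D {k} = emeasure q {k}"
      by (simp add: D.emeasure_eq_measure measure_pmf.emeasure_eq_measure)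
  qed auto
qed

text \<open>A column is drawn through its rank. The distribution function at rank \<open>k\<close>
  is the mass of \<open>Suc k\<close> columns, those of ranks 0 to \<open>k\<close>.\<close>

definition quantile_step :: "(nat list \<Rightarrow> nat pmf) \<Rightarrow> nat list \<Rightarrow> real \<Rightarrow> nat list" where
  "quantile_step p s u =
     incr s (ranked s ! quantile (length s) (\<lambda>k. measure (p s) (top_columns (Suc k) s)) u)"

lemma measurable_quantile_step: "quantile_step p s \<in> measurable uniform01 (count_space UNIV)"
  unfolding quantile_step_def by (rule measurable_compose[OF measurable_quantile]) simp

text \<open>\<open>ranked s\<close> is a bijection from ranks to columns. The law \<open>q\<close>
  of the rank has the masses of the top columns as its distribution function, and its image under
  the bijection is \<open>p s\<close>.\<close>

lemma distr_quantile_step: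
  assumes supp: "set_pmf (p s) \<subseteq> {..<length s}"
  shows "distr uniform01 (count_space UNIV) (quantile_step p s) = measure_pmf (map_pmf (incr s) (p s))"
proof -
  define rank where "rank = inv_into {..<length s} ((!) (ranked s))"
  have inj: "inj_on ((!) (ranked s)) {..<length s}"
    by (simp add: inj_on_def nth_eq_iff_index_eq)
  have img: "(!) (ranked s) ` {..<length s} = {..<length s}"
    using top_columns_image[of "length s" s] by simp
  have rank: "ranked s ! rank i = i" "rank i < length s" if "i < length s" for i
    using that img unfolding rank_def
    by (auto intro: f_inv_into_f inv_into_into[where A="{..<length s}", simplified])
  define q where "q = map_pmf rank (p s)"
  have q: "set_pmf q \<subseteq> {..<length s}"
    using supp rank by (auto simp: q_def)
  have p: "p s = map_pmf ((!) (ranked s)) q"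
    unfolding q_def pmf.map_comp
    by (rule pmf.map_ident_strong[symmetric]) (use supp rank in auto)
  have "measure q {..k} = measure (p s) (top_columns (Suc k) s)" if "k < length s" for k
  proof -
    have "measure q {..k} = measure (p s) (rank -` {..k})"
      by (simp add: q_def)
    also have "\<dots> = measure (p s) (top_columns (Suc k) s)"
    proof (rule measure_pmf.finite_measure_eq_AE)
      have "rank i \<le> k \<longleftrightarrow> i \<in> top_columns (Suc k) s" if "i \<in> set_pmf (p s)" for i
      proof -
        have i: "i < length s" using supp that by auto
        show ?thesis
        proof
          assume "rank i \<le> k"
          then show "i \<in> top_columns (Suc k) s"
            using rank(1)[OF i, symmetric] \<open>k < length s\<close> by (simp add: top_columns_image image_eqI)
        next
          assume "i \<in> top_columns (Suc k) s"
          then obtain a where "a < Suc k" "ranked s ! a = i"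
            using \<open>k < length s\<close> by (auto simp: in_top_columns_iff)
          then show "rank i \<le> k"
            using inv_into_f_f[OF inj, of a] \<open>k < length s\<close> by (auto simp: rank_def)
        qed
      qed
      then show "AE i in p s. (i \<in> rank -` {..k}) = (i \<in> top_columns (Suc k) s)"
        by (simp add: AE_measure_pmf_iff)
    qed auto
    finally show ?thesis .
  qed
  then have step: "quantile_step p s =
      (\<lambda>k. incr s (ranked s ! k)) \<circ> quantile (length s) (\<lambda>k. measure q {..k})"
    unfolding quantile_step_def by (auto simp: fun_eq_iff cong: quantile_cong)
  have "distr uniform01 (count_space UNIV) (quantile_step p s) =
     distr (measure_pmf q) (count_space UNIV) (\<lambda>k. incr s (ranked s ! k))"
    unfolding step by (subst distr_quantile[OF q, symmetric], subst distr_distr) auto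
  also have "\<dots> = measure_pmf (map_pmf (incr s) (p s))"
    unfolding p pmf.map_comp map_pmf_rep_eq by (simp add: o_def)
  finally show ?thesis .
qed

text \<open>Reduces the coupling to a one-step inequality: more mass on the top columns means a
  smaller quantile rank, which is what \<open>dominates_incr\<close> asks of the dominating
  process.\<close>

lemma coupling_dominates_incr:
  assumes N: "0 < N"
    and k: "\<And>s. length s = N \<Longrightarrow> k s = map_pmf (incr s) (p s)"
    and l: "\<And>s. length s = N \<Longrightarrow> l s = map_pmf (incr s) (q s)"
    and p: "\<And>s. length s = N \<Longrightarrow> set_pmf (p s) \<subseteq> {..<N}"
    and q: "\<And>s. length s = N \<Longrightarrow> set_pmf (q s) \<subseteq> {..<N}"
    and le: "\<And>s e j. length s = N \<Longrightarrow> dominates s e \<Longrightarrow> j \<le> N \<Longrightarrow>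
      measure (q e) (top_columns j e) \<le> measure (p s) (top_columns j s)"
  shows "coupling_dominates (\<lambda>s. measure_pmf (k s)) (replicate N 0)
    (\<lambda>s. measure_pmf (l s)) (replicate N 0)"
proof (rule coupling_dominatesI[where P="\<lambda>s. length s = N"
      and R="\<lambda>s e. length s = N \<and> dominates s e"])
  show "quantile_step p s \<in> measurable uniform01 (count_space UNIV)"
    "quantile_step q s \<in> measurable uniform01 (count_space UNIV)" for s
    by (rule measurable_quantile_step)+
  show "distr uniform01 (count_space UNIV) (quantile_step p s) = measure_pmf (k s)"
    if "length s = N" for s
    using distr_quantile_step[of p s] p k that by simp
  show "distr uniform01 (count_space UNIV) (quantile_step q s) = measure_pmf (l s)"
    if "length s = N" for s
    using distr_quantile_step[of q s] q l that by simp
  show "length (quantile_step p s u) = N \<and> dominates (quantile_step p s u) (quantile_step q e u)"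
    if "length s = N \<and> dominates s e" for s e u
  proof -
    have len: "length s = N" "length e = N" and dom: "dominates s e"
      using that by (auto simp: dominates_def)
    show ?thesis
      unfolding quantile_step_def using len N
      by (auto intro!: dominates_incr[OF dom] quantile_mono quantile_less le dom)
  qed
qed (auto simp: prob_space_uniform01 quantile_step_def dominates_more_monopolistic, simp add: dominates_def)

section \<open>Polya's urn and random allocation\<close>

definition polya_column :: "nat \<Rightarrow> nat list \<Rightarrow> nat pmf" where
  "polya_column N e = pmf_of_multiset (mset (concat (map (\<lambda>i. replicate (e ! i + 1) i) [0..<N])))"

lemma count_concat_replicate:
  "count (mset (concat (map (\<lambda>i. replicate (f i) i) [0..<n]))) j = (if j < n then f j else 0)"
  by (induction n) auto

lemma pmf_polya_column:
  assumes "length e = N" "0 < N"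
  shows "pmf (polya_column N e) i = (if i < N then real (e ! i + 1) / real (sum_list e + N) else 0)"
proof -
  let ?A = "mset (concat (map (\<lambda>i. replicate (e ! i + 1) i) [0..<N]))"
  have "size ?A = (\<Sum>i<N. e ! i + 1)"
    by (simp add: length_concat o_def interv_sum_list_conv_sum_set_nat lessThan_atLeast0 del: sum_mset_sum_list)
  also have "\<dots> = sum_list e + N"
    using assms by (simp add: sum_list_sum_nth lessThan_atLeast0 sum_Suc)
  finally have size: "size ?A = sum_list e + N" .
  have ne: "?A \<noteq> {#}"
  proof
    assume "?A = {#}"
    then have "size ?A = 0" by (rule arg_cong[where f=size, THEN trans]) simp
    with size assms(2) show False by linarith
  qed
  show ?thesis
    unfolding polya_column_def pmf_of_multiset[OF ne] size count_concat_replicate by simp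
qed

lemma set_polya_column:
  assumes "length e = N" "0 < N"
  shows "set_pmf (polya_column N e) \<subseteq> {..<N}"
  using pmf_polya_column[OF assms] by (auto simp: set_pmf_iff split: if_splits)

lemma measure_polya_column:
  assumes "length e = N" "0 < N" "T \<subseteq> {..<N}"
  shows "measure (polya_column N e) T = real (\<Sum>i\<in>T. e ! i + 1) / real (sum_list e + N)"
proof -
  have "measure (polya_column N e) T = (\<Sum>i\<in>T. pmf (polya_column N e) i)"
    using assms finite_subset by (intro measure_measure_pmf_finite) auto
  also have "\<dots> = (\<Sum>i\<in>T. real (e ! i + 1) / real (sum_list e + N))"
    using assms by (intro sum.cong refl) (subst pmf_polya_column, auto)
  finally show ?thesis
    by (simp add: sum_divide_distrib)
qed

lemma polya_column_mono:
  assumes "length s = N" "0 < N" "dominates s e" "k \<le> N"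
  shows "measure (polya_column N e) (top_columns k e) \<le> measure (polya_column N s) (top_columns k s)"
proof -
  have len: "length e = N" and tot: "sum_list s = sum_list e"
    using assms by (auto simp: dominates_def)
  have "(\<Sum>i\<in>top_columns k e. e ! i + 1) \<le> (\<Sum>i\<in>top_columns k s. s ! i + 1)"
    using dominates_sum_top[OF assms(3)] assms len
    by (simp only: sum.distrib) (simp add: card_top_columns)
  then show ?thesis
    using assms len tot top_columns_subset[of k e] top_columns_subset[of k s]
    by (simp only: measure_polya_column) (intro divide_right_mono of_nat_mono, simp_all)
qed

lemma uniform_le_polya_column:
  assumes "length s = N" "0 < N" "k \<le> N"
  shows "real k / real N \<le> measure (polya_column N s) (top_columns k s)"
proof -
  have "k * sum_list s \<le> N * (\<Sum>i\<in>top_columns k s. s ! i)"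
  proof (cases k)
    case (Suc l)
    \<comment> \<open>At the \<open>k\<close>-th largest height, the sum of the \<open>k\<close>
      largest heights is exactly \<open>k * ?c\<close> plus the excess, and the total is at most
      \<open>N * ?c\<close> plus the same excess. What remains is \<open>k\<close> \<le>
      \<open>N\<close>.\<close>
    let ?c = "s ! (ranked s ! l)"
    have "sum_list s \<le> N * ?c + excess ?c s"
      using sum_le_excess[of "{..<N}" s ?c] assms by (simp add: sum_list_sum_nth lessThan_atLeast0)
    then have "k * sum_list s \<le> k * (N * ?c + excess ?c s)"
      by simp
    also have "\<dots> \<le> N * (k * ?c + excess ?c s)"
      using assms by (simp add: algebra_simps)
    also have "\<dots> = N * (\<Sum>i\<in>top_columns k s. s ! i)"
      using sum_top_excess[of l s] Suc assms by simp
    finally show ?thesis .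
  qed simp
  then have "k * (sum_list s + N) \<le> (\<Sum>i\<in>top_columns k s. s ! i + 1) * N"
    using assms unfolding sum.distrib by (simp add: card_top_columns algebra_simps)
  then have "real (k * (sum_list s + N)) \<le> real ((\<Sum>i\<in>top_columns k s. s ! i + 1) * N)"
    by (rule of_nat_mono)
  then show ?thesis
    using assms top_columns_subset[of k s]
    by (subst measure_polya_column) (auto simp: field_simps)
qed

lemma polya_dominates_allocation:
  assumes "0 < N"
  shows "coupling_dominates (polya_step N) (replicate N 0) (allocation_step N) (replicate N 0)"
proof -
  have "coupling_dominates (\<lambda>s. measure_pmf (map_pmf (incr s) (polya_column N s))) (replicate N 0)
    (\<lambda>s. measure_pmf (map_pmf (incr s) (pmf_of_set {0..<N}))) (replicate N 0)"
  proof (rule coupling_dominates_incr[OF assms refl refl])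
    show "measure (pmf_of_set {0..<N}) (top_columns j e) \<le> measure (polya_column N s) (top_columns j s)"
      if "length s = N" "dominates s e" "j \<le> N" for s e j
    proof -
      have "length e = N" using that by (auto simp: dominates_def)
      then have "{0..<N} \<inter> top_columns j e = top_columns j e" "card (top_columns j e) = j"
        using top_columns_subset[of j e] that by (auto simp: card_top_columns)
      then show ?thesis
        using uniform_le_polya_column[of s N j] that assms by (simp add: measure_pmf_of_set)
    qed
  qed (use assms set_polya_column in auto)
  then show ?thesis
    by (simp add: polya_step_def[abs_def] allocation_step_def[abs_def] polya_column_def)
qed

section \<open>Green functions of killed walks\<close>

text \<open>For \<open>y\<close> \<le> \<open>z\<close> both \<open>g z - g y\<close> and
  \<open>k z * a y - k y * a z\<close> are nonnegative, and exchanging \<open>y\<close> and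
  \<open>z\<close> flips both. The double sum of their product is twice the difference of the two
  sides.\<close>

lemma chebyshev_weighted:
  fixes g k a :: "nat \<Rightarrow> real"
  assumes "mono g"
    and ratio: "\<And>y z. y \<le> z \<Longrightarrow> k y * a z \<le> k z * a y"
  shows "(\<Sum>z\<le>M. k z) * (\<Sum>z\<le>M. g z * a z) \<le> (\<Sum>z\<le>M. g z * k z) * (\<Sum>z\<le>M. a z)"
proof -
  have "0 \<le> (g z - g y) * (k z * a y - k y * a z)" for y z
  proof (cases "y \<le> z")
    case True
    then show ?thesis
      using monoD[OF \<open>mono g\<close>, of y z] ratio[of y z] by simp
  next
    case False
    then show ?thesis
      using monoD[OF \<open>mono g\<close>, of z y] ratio[of z y] by (intro mult_nonpos_nonpos) simp_all
  qed
  then have "0 \<le> (\<Sum>y\<le>M. \<Sum>z\<le>M. (g z - g y) * (k z * a y - k y * a z))"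
    by (intro sum_nonneg) simp
  also have "\<dots> = (\<Sum>y\<le>M. \<Sum>z\<le>M. (g z * k z) * a y) + (\<Sum>y\<le>M. \<Sum>z\<le>M. (g y * k y) * a z)
      - (\<Sum>y\<le>M. \<Sum>z\<le>M. k y * (g z * a z)) - (\<Sum>y\<le>M. \<Sum>z\<le>M. k z * (g y * a y))"
    by (simp add: sum.distrib[symmetric] sum_subtractf[symmetric] algebra_simps)
  also have "\<dots> = 2 * ((\<Sum>z\<le>M. g z * k z) * (\<Sum>z\<le>M. a z) - (\<Sum>z\<le>M. k z) * (\<Sum>z\<le>M. g z * a z))"
  proof -
    have "(\<Sum>y\<le>M. \<Sum>z\<le>M. (g z * k z) * a y) = (\<Sum>z\<le>M. g z * k z) * (\<Sum>z\<le>M. a z)"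
      "(\<Sum>y\<le>M. \<Sum>z\<le>M. k z * (g y * a y)) = (\<Sum>z\<le>M. k z) * (\<Sum>z\<le>M. g z * a z)"
      by (subst sum.swap, rule sum_product[symmetric])+
    then show ?thesis
      by (simp add: sum_product[symmetric])
  qed
  finally show ?thesis by simp
qed

text \<open>Only used for \<open>z > 0\<close> and increments at least \<open>-1\<close>, where \<^const>\<open>nat\<close> does not truncate.\<close>

definition step_mean :: "int pmf \<Rightarrow> (nat \<Rightarrow> real) \<Rightarrow> nat \<Rightarrow> real" where
  "step_mean inc h z = measure_pmf.expectation inc (\<lambda>d. h (nat (int z + d)))"

text \<open>A walk killed at height \<open>z\<close> with probability \<open>1 - d z\<close> has, started above \<open>M\<close>, an expected number of
  visits \<open>g z / c\<close> to height \<open>z\<close>. Requiring the formula for every bounded solution,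
  in particular for \<open>h = 1\<close>, makes it imply that the walk is killed almost surely.\<close>

definition monotone_green :: "int pmf \<Rightarrow> bool" where
  "monotone_green inc \<longleftrightarrow>
     (\<forall>d M. mono d \<longrightarrow> d 0 = 0 \<longrightarrow> (\<forall>z. d z \<le> 1) \<longrightarrow> (\<forall>z>M. d z = 1) \<longrightarrow>
       (\<exists>g c. mono g \<and> c > 0 \<and>
         (\<forall>h k. (\<forall>z. 0 \<le> h z \<and> h z \<le> 1) \<longrightarrow> (\<forall>z>M. k z = 0) \<longrightarrow>
            (\<forall>z. h z = k z + d z * step_mean inc h z) \<longrightarrow>
            c * h (Suc M) = (\<Sum>z\<le>M. g z * k z))))"

text \<open>A falling explorer meets each height at most once, so its Green function is the
  probability of passing all heights from \<open>M\<close> down to \<open>z + 1\<close>. A lower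
  height adds factors at most 1.\<close>

lemma monotone_green_ballistic: "monotone_green (return_pmf (-1))"
  unfolding monotone_green_def
proof (intro allI impI)
  fix d :: "nat \<Rightarrow> real" and M :: nat
  assume d: "mono d" "d 0 = 0" "\<forall>z. d z \<le> 1" "\<forall>z>M. d z = 1"
  have d0: "0 \<le> d z" for z
    using monoD[OF d(1), of 0 z] d(2) by simp
  define g where "g z = (\<Prod>y\<in>{Suc z..M}. d y)" for z
  have g_Suc: "g z = d (Suc z) * g (Suc z)" if "z < M" for z
    using that unfolding g_def by (simp add: prod.atLeast_Suc_atMost)
  have g_top: "g z = 1" if "M \<le> z" for z
    using that by (simp add: g_def)
  have "mono g"
  proof (rule incseq_SucI)
    fix z
    have "0 \<le> g (Suc z)"
      unfolding g_def by (intro prod_nonneg) (simp add: d0)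
    then show "g z \<le> g (Suc z)"
      using g_Suc[of z] g_top[of z] g_top[of "Suc z"] d(3) d0
      by (cases "z < M") (auto intro: mult_left_le_one_le)
  qed
  moreover have "1 * h (Suc M) = (\<Sum>z\<le>M. g z * k z)"
    if k: "\<forall>z>M. k z = 0" and eq: "\<forall>z. h z = k z + d z * step_mean (return_pmf (-1)) h z"
    for h k :: "nat \<Rightarrow> real"
  proof -
    have h0: "h 0 = k 0"
      using eq[rule_format, of 0] d(2) by simp
    have hS: "h (Suc z) = k (Suc z) + d (Suc z) * h z" for z
      using eq[rule_format, of "Suc z"] by (simp add: step_mean_def)
    \<comment> \<open>The sum telescopes to one boundary term, and \<open>g M = 1\<close>.\<close>
    have "(\<Sum>z\<le>n. g z * k z) = g n * h n" if "n \<le> M" for n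
      using that
    proof (induction n)
      case 0
      show ?case by (simp add: h0)
    next
      case (Suc n)
      then show ?case
        using g_Suc[of n] by (simp add: hS algebra_simps)
    qed
    then show ?thesis
      using hS[of M] k d(4) g_top by simp
  qed
  ultimately show "\<exists>g c. mono g \<and> c > 0 \<and>
         (\<forall>h k. (\<forall>z. 0 \<le> h z \<and> h z \<le> 1) \<longrightarrow> (\<forall>z>M. k z = 0) \<longrightarrow>
            (\<forall>z. h z = k z + d z * step_mean (return_pmf (-1)) h z) \<longrightarrow>
            c * h (Suc M) = (\<Sum>z\<le>M. g z * k z))"
    by (intro exI[of _ g] exI[of _ "1::real"]) auto
qed

section \<open>Diffusive explorers\<close>

lemma step_mean_diffusive:
  "0 < z \<Longrightarrow> step_mean (pmf_of_set {-1, 1}) h z = (h (Suc z) + h (z - 1)) / 2"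
  by (simp add: step_mean_def integral_pmf_of_set nat_add_distrib nat_diff_distrib)

text \<open>With \<open>u = d * g\<close>, the equation of the Green function becomes the recursion below. Its solution is
  convex because \<open>d \<le> 1\<close>, which makes both \<open>u\<close> and \<open>g\<close> nondecreasing.\<close>

fun killed_harmonic :: "(nat \<Rightarrow> real) \<Rightarrow> nat \<Rightarrow> real" where
  "killed_harmonic d 0 = 0"
| "killed_harmonic d (Suc 0) = 1"
| "killed_harmonic d (Suc (Suc n)) = 2 * killed_harmonic d (Suc n) / d (Suc n) - killed_harmonic d n"

text \<open>Dividing by \<open>d (Suc n)\<close> \<le> 1 makes second differences nonnegative, so no
  increment falls below the first one, which is 1.\<close>

lemma killed_harmonic_increment:
  assumes "\<And>n. 0 < d (Suc n) \<and> d (Suc n) \<le> 1"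
  shows "0 \<le> killed_harmonic d n \<and> killed_harmonic d n + 1 \<le> killed_harmonic d (Suc n)"
proof (induction n)
  case 0
  show ?case by simp
next
  case (Suc n)
  have "killed_harmonic d (Suc n) \<le> killed_harmonic d (Suc n) / d (Suc n)"
    using Suc assms[of n] by (simp add: le_divide_eq mult_left_le)
  then show ?case using Suc by simp
qed

text \<open>\<open>d\<close> vanishes at heights reached by all columns, where the recursion would
  divide by 0. It is started at the last zero \<open>m\<close> of \<open>d\<close> instead.\<close>

lemma killed_harmonic_exists:
  fixes d :: "nat \<Rightarrow> real"
  assumes d: "mono d" "d 0 = 0" "\<And>z. d z \<le> 1" "d (Suc M) = 1"
  obtains u :: "nat \<Rightarrow> real" where "u 0 = 0" "mono u" "u M < u (Suc M)"
    "\<And>z. u z = d z * ((u (Suc z) + u (z - 1)) / 2)"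
proof -
  define m where "m = (LEAST z. d (Suc z) \<noteq> 0)"
  have m: "d (Suc m) \<noteq> 0"
    unfolding m_def by (rule LeastI[of _ M]) (simp add: d)
  have mM: "m \<le> M"
    unfolding m_def by (rule Least_le) (simp add: d)
  have zero: "d z = 0" if "z \<le> m" for z
  proof (cases z)
    case (Suc y)
    then show ?thesis
      using not_less_Least[of y "\<lambda>z. d (Suc z) \<noteq> 0"] that by (simp add: m_def)
  qed (simp add: d)
  have pos: "0 < d (m + Suc n) \<and> d (m + Suc n) \<le> 1" for n
    using monoD[OF d(1), of "Suc m" "m + Suc n"] monoD[OF d(1), of 0 "Suc m"] m d by simp
  define v where "v = killed_harmonic (\<lambda>n. d (m + n))"
  have v: "0 \<le> v n" "v n + 1 \<le> v (Suc n)" for n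
    using killed_harmonic_increment[of "\<lambda>n. d (m + n)" n] pos by (auto simp: v_def)
  \<comment> \<open>Truncated subtraction makes \<open>u\<close> vanish up to
    \<open>m\<close>.\<close>
  define u where "u z = v (z - m)" for z
  have "u 0 = 0" by (simp add: u_def v_def)
  moreover have "mono u"
  proof (rule incseq_SucI)
    fix z
    show "u z \<le> u (Suc z)"
      using v(2)[of "z - m"] by (cases "m \<le> z") (auto simp: u_def Suc_diff_le)
  qed
  moreover have "u M < u (Suc M)"
    using v(2)[of "M - m"] mM by (simp add: u_def Suc_diff_le)
  moreover have "u z = d z * ((u (Suc z) + u (z - 1)) / 2)" for z
  proof (cases "z \<le> m")
    case True
    then show ?thesis by (simp add: u_def v_def zero)
  next
    case False
    then obtain n where z: "z = m + Suc n"
      using less_imp_add_positive[of m z] by (metis gr0_conv_Suc not_le)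
    have "d z \<noteq> 0" using pos[of n] z by simp
    then show ?thesis
      using z by (simp add: u_def v_def)
  qed
  ultimately show ?thesis by (rule that)
qed

text \<open>A bounded arithmetic progression is constant. This is the boundary condition above the
  highest column, where the walk is free.\<close>

lemma bounded_linear_sequence:
  fixes h :: "nat \<Rightarrow> real"
  assumes "\<And>z. 0 \<le> h z \<and> h z \<le> 1" and lin: "\<And>n. h (Suc (Suc n)) - h (Suc n) = h (Suc n) - h n"
  shows "h (Suc 0) = h 0"
proof -
  define e where "e = h (Suc 0) - h 0"
  have diff: "h (Suc n) - h n = e" for n
    by (induction n) (simp_all add: e_def lin)
  have sum: "h n = h 0 + real n * e" for n
  proof (induction n)
    case (Suc n)
    have "h (Suc n) = h n + e"
      using diff[of n] by simp
    then show ?case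
      using Suc by (simp add: algebra_simps)
  qed simp
  show ?thesis
  proof (rule ccontr)
    assume "h (Suc 0) \<noteq> h 0"
    then have "0 < \<bar>e\<bar>" by (simp add: e_def)
    then obtain n where n: "1 < real n * \<bar>e\<bar>"
      using reals_Archimedean3 by blast
    have "real n * \<bar>e\<bar> = \<bar>h n - h 0\<bar>"
      using sum[of n] by (simp add: abs_mult)
    also have "\<dots> \<le> 1"
      using assms(1)[of n] assms(1)[of 0] by (simp add: abs_le_iff)
    finally show False using n by simp
  qed
qed

lemma monotone_green_diffusive: "monotone_green (pmf_of_set {-1, 1})"
  unfolding monotone_green_def
proof (intro allI impI)
  fix d :: "nat \<Rightarrow> real" and M :: nat
  assume d: "mono d" "d 0 = 0" "\<forall>z. d z \<le> 1" "\<forall>z>M. d z = 1"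
  have d': "\<And>z. d z \<le> 1" "d (Suc M) = 1"
    using d by auto
  obtain u where u: "u 0 = 0" "mono u" "u M < u (Suc M)"
    and u_eq: "\<And>z. u z = d z * ((u (Suc z) + u (z - 1)) / 2)"
    using killed_harmonic_exists[OF d(1,2) d'] by blast
  \<comment> \<open>Now \<open>u_eq\<close> reads \<open>u = d * g\<close>, and \<open>g\<close>
    inherits monotonicity from \<open>u\<close>. At \<open>z = 0\<close> the truncated
    \<open>z - 1\<close> contributes \<open>u 0 = 0\<close>.\<close>
  define g where "g z = (u (Suc z) + u (z - 1)) / 2" for z
  have "mono g"
    unfolding g_def by (intro monoI divide_right_mono add_mono monoD[OF u(2)]) auto
  moreover have "(u (Suc M) - u M) / 2 * h (Suc M) = (\<Sum>z\<le>M. g z * k z)"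
    if bdd: "\<forall>z. 0 \<le> h z \<and> h z \<le> 1" and k: "\<forall>z>M. k z = 0"
      and eq: "\<forall>z. h z = k z + d z * step_mean (pmf_of_set {-1, 1}) h z"
    for h k :: "nat \<Rightarrow> real"
  proof -
    have h0: "h 0 = k 0"
      using eq[rule_format, of 0] d(2) by simp
    have hS: "h (Suc z) = k (Suc z) + d (Suc z) * ((h (Suc (Suc z)) + h z) / 2)" for z
      using eq[rule_format, of "Suc z"] by (simp add: step_mean_diffusive)
    \<comment> \<open>Above \<open>M\<close>, \<open>d = 1\<close> and \<open>k = 0\<close>, so
      \<open>h\<close> is affine from \<open>M\<close> on.\<close>
    have "h (M + Suc 0) = h (M + 0)"
    proof (rule bounded_linear_sequence[of "\<lambda>n. h (M + n)"])
      fix n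
      show "h (M + Suc (Suc n)) - h (M + Suc n) = h (M + Suc n) - h (M + n)"
        using hS[of "M + n"] k d(4) by simp
    qed (use bdd in auto)
    then have hM: "h (Suc M) = h M" by simp
    \<comment> \<open>Summation by parts leaves half the discrete Wronskian of \<open>u\<close> and
      \<open>h\<close>. At \<open>n = M\<close>, equal values of \<open>h\<close> turn it into the
      constant times \<open>h (Suc M)\<close>.\<close>
    have "(\<Sum>z\<le>n. g z * k z) = (u (Suc n) * h n - u n * h (Suc n)) / 2" for n
    proof (induction n)
      case 0
      show ?case by (simp add: h0 g_def u(1))
    next
      case (Suc n)
      have "g (Suc n) * k (Suc n) = g (Suc n) * h (Suc n) - u (Suc n) * ((h (Suc (Suc n)) + h n) / 2)"
      proof -
        have k: "k (Suc n) = h (Suc n) - d (Suc n) * ((h (Suc (Suc n)) + h n) / 2)"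
          using hS[of n] by simp
        have u: "u (Suc n) = d (Suc n) * g (Suc n)"
          using u_eq[of "Suc n"] by (simp only: g_def)
        show ?thesis
          unfolding k u by (simp add: algebra_simps)
      qed
      then show ?case
        using Suc by (simp add: g_def field_simps)
    qed
    from this[of M] show ?thesis
      by (simp add: hM field_simps)
  qed
  ultimately show "\<exists>g c. mono g \<and> c > 0 \<and>
         (\<forall>h k. (\<forall>z. 0 \<le> h z \<and> h z \<le> 1) \<longrightarrow> (\<forall>z>M. k z = 0) \<longrightarrow>
            (\<forall>z. h z = k z + d z * step_mean (pmf_of_set {-1, 1}) h z) \<longrightarrow>
            c * h (Suc M) = (\<Sum>z\<le>M. g z * k z))"
    using u(3) by (intro exI[of _ g] exI[of _ "(u (Suc M) - u M) / 2"]) auto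
qed

section \<open>First-step analysis of an explorer\<close>

text \<open>Explorers are started from an arbitrary height \<open>z\<close> here, to allow a first-step analysis.\<close>

definition hits :: "nat list \<Rightarrow> int \<Rightarrow> nat stream \<Rightarrow> int stream \<Rightarrow> nat \<Rightarrow> bool" where
  "hits s z xs ds n \<longleftrightarrow> z + (\<Sum>k<n. ds !! k) \<le> int (s ! (xs !! n))"

definition hit_in :: "nat list \<Rightarrow> nat set \<Rightarrow> int \<Rightarrow> nat stream \<times> int stream \<Rightarrow> bool" where
  "hit_in s T z \<omega> \<longleftrightarrow> (\<exists>n. hits s z (fst \<omega>) (snd \<omega>) n \<and>
     fst \<omega> !! (LEAST n. hits s z (fst \<omega>) (snd \<omega>) n) \<in> T)"

abbreviation walk_space :: "nat \<Rightarrow> int pmf \<Rightarrow> (nat stream \<times> int stream) measure" where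
  "walk_space N inc \<equiv> stream_space (measure_pmf (pmf_of_set {0..<N})) \<Otimes>\<^sub>M stream_space (measure_pmf inc)"

definition hit_prob :: "nat \<Rightarrow> int pmf \<Rightarrow> nat list \<Rightarrow> nat set \<Rightarrow> int \<Rightarrow> real" where
  "hit_prob N inc s T z = measure (walk_space N inc) {\<omega>. hit_in s T z \<omega>}"

lemma hits_0: "hits s z (x ## xs) ds 0 \<longleftrightarrow> z \<le> int (s ! x)"
  by (simp add: hits_def)

lemma hits_Suc: "hits s z (x ## xs) (d ## ds) (Suc n) \<longleftrightarrow> hits s (z + d) xs ds n"
  by (simp add: hits_def sum.lessThan_Suc_shift add.assoc del: sum.lessThan_Suc)

text \<open>First-step decomposition on paths: an explorer that does not stop at once continues
  along the shifted streams from its new height.\<close>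

lemma hit_in_SCons:
  "hit_in s T z (x ## xs, d ## ds) \<longleftrightarrow> (if z \<le> int (s ! x) then x \<in> T else hit_in s T (z + d) (xs, ds))"
proof (cases "z \<le> int (s ! x)")
  case True
  then have "(LEAST n. hits s z (x ## xs) (d ## ds) n) = 0"
    by (intro Least_equality) (auto simp: hits_0)
  then show ?thesis
    using True hits_0[of s z x xs "d ## ds"] by (auto simp: hit_in_def)
next
  case False
  let ?H = "hits s z (x ## xs) (d ## ds)"
  have no0: "\<not> ?H 0"
    using False by (simp add: hits_0)
  have least: "(LEAST n. ?H n) = Suc (LEAST n. hits s (z + d) xs ds n)" if "?H n" for n
    using Least_Suc[of ?H n] that no0 by (simp add: hits_Suc)
  have ex: "(\<exists>n. ?H n) \<longleftrightarrow> (\<exists>n. hits s (z + d) xs ds n)"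
    using no0 by (metis hits_Suc not0_implies_Suc)
  have "hit_in s T z (x ## xs, d ## ds) \<longleftrightarrow> (\<exists>n. ?H n) \<and> (x ## xs) !! (LEAST n. ?H n) \<in> T"
    by (auto simp: hit_in_def)
  also have "\<dots> \<longleftrightarrow> (\<exists>n. hits s (z + d) xs ds n) \<and> xs !! (LEAST n. hits s (z + d) xs ds n) \<in> T"
    using ex least by (metis snth.simps(2) stream.sel(2))
  also have "\<dots> \<longleftrightarrow> hit_in s T (z + d) (xs, ds)"
    by (auto simp: hit_in_def)
  finally show ?thesis
    using False by simp
qed

section \<open>Measurability of hitting events\<close>

lemma measurable_countable_binop:
  fixes f :: "'a \<Rightarrow> 'b::countable"
  assumes "f \<in> measurable M (count_space UNIV)" "g \<in> measurable M (count_space UNIV)"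
  shows "(\<lambda>x. F (f x) (g x)) \<in> measurable M (count_space UNIV)"
  by (rule measurable_compose_countable[OF _ assms(1)], rule measurable_compose[OF assms(2)]) simp

lemma measurable_snth_pmf [measurable]:
  "(\<lambda>xs. xs !! n) \<in> measurable (stream_space (measure_pmf p)) (count_space UNIV)"
  using measurable_snth[of n "measure_pmf p"] by (simp cong: measurable_cong_sets)

lemma measurable_columns [measurable]: "(\<lambda>\<omega>. fst \<omega> !! n) \<in> measurable (walk_space N inc) (count_space UNIV)"
  by (rule measurable_compose[OF measurable_fst measurable_snth_pmf])

lemma measurable_heights: "(\<lambda>\<omega>. \<Sum>k<n. snd \<omega> !! k) \<in> measurable (walk_space N inc) (count_space UNIV)"
proof (induction n)
  case (Suc n)
  show ?case
    unfolding sum.lessThan_Suc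
    by (rule measurable_countable_binop[OF Suc])
      (rule measurable_compose[OF measurable_snd measurable_snth_pmf])
qed simp

lemma pred_hits [measurable]:
  "Measurable.pred (walk_space N inc) (\<lambda>\<omega>. hits s z (fst \<omega>) (snd \<omega>) n)"
  unfolding hits_def by (rule measurable_countable_binop[OF measurable_heights measurable_columns])

lemma measurable_hit_column [measurable]:
  "(\<lambda>\<omega>. fst \<omega> !! (LEAST n. hits s z (fst \<omega>) (snd \<omega>) n)) \<in> measurable (walk_space N inc) (count_space UNIV)"
proof (rule measurable_compose_countable[where g="\<lambda>\<omega>. LEAST n. hits s z (fst \<omega>) (snd \<omega>) n"])
  show "(\<lambda>\<omega>. LEAST n. hits s z (fst \<omega>) (snd \<omega>) n) \<in> measurable (walk_space N inc) (count_space UNIV)"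
    by measurable
qed (rule measurable_columns)

lemma pred_hit_in [measurable]: "Measurable.pred (walk_space N inc) (hit_in s T z)"
proof -
  have "Measurable.pred (walk_space N inc)
      (\<lambda>\<omega>. fst \<omega> !! (LEAST n. hits s z (fst \<omega>) (snd \<omega>) n) \<in> T)"
    by (rule measurable_compose[OF measurable_hit_column]) simp
  then show ?thesis
    unfolding hit_in_def[abs_def] by measurable
qed

lemma prob_space_walk_space: "prob_space (walk_space N inc)"
proof -
  interpret X: prob_space "stream_space (measure_pmf (pmf_of_set {0..<N}))"
    by (rule prob_space.prob_space_stream_space[OF prob_space_measure_pmf])
  interpret D: prob_space "stream_space (measure_pmf inc)"
    by (rule prob_space.prob_space_stream_space[OF prob_space_measure_pmf])
  interpret pair_prob_space "stream_space (measure_pmf (pmf_of_set {0..<N}))" "stream_space (measure_pmf inc)" ..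
  show ?thesis by (rule prob_space_axioms)
qed

lemma space_walk_space [simp]: "space (walk_space N inc) = UNIV"
  by (simp add: space_pair_measure space_stream_space streams_UNIV)

lemma hit_prob_bounds: "0 \<le> hit_prob N inc s T z \<and> hit_prob N inc s T z \<le> 1"
  unfolding hit_prob_def using prob_space.prob_le_1[OF prob_space_walk_space] by auto

lemma emeasure_hit_in:
  "emeasure (walk_space N inc) {\<omega>. hit_in s T z \<omega>} =
    (\<integral>\<^sup>+x. (if z \<le> int (s ! x) then indicator T x
       else (\<integral>\<^sup>+d. emeasure (walk_space N inc) {\<omega>. hit_in s T (z + d) \<omega>} \<partial>inc)) \<partial>pmf_of_set {0..<N})"
proof -
  let ?p = "measure_pmf (pmf_of_set {0..<N})"
  let ?X = "stream_space ?p" and ?D = "stream_space (measure_pmf inc)"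
  interpret X: prob_space ?X by (rule prob_space.prob_space_stream_space[OF prob_space_measure_pmf])
  interpret D: prob_space ?D by (rule prob_space.prob_space_stream_space[OF prob_space_measure_pmf])
  interpret XD: pair_sigma_finite ?X ?D ..
  interpret Xi: pair_sigma_finite ?X "measure_pmf inc" ..
  define f where "f y \<omega> = (indicator {\<omega>. hit_in s T y \<omega>} \<omega> :: ennreal)" for y \<omega>
  have f[measurable]: "f y \<in> borel_measurable (walk_space N inc)" for y
    unfolding f_def by (intro borel_measurable_indicator) (use pred_hit_in[where N=N and inc=inc and s=s and T=T and z=y] in \<open>simp add: pred_def\<close>)
  have em: "emeasure (walk_space N inc) {\<omega>. hit_in s T y \<omega>} = (\<integral>\<^sup>+xs. \<integral>\<^sup>+ds. f y (xs, ds) \<partial>?D \<partial>?X)" for y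
  proof -
    have "emeasure (walk_space N inc) {\<omega>. hit_in s T y \<omega>} = (\<integral>\<^sup>+\<omega>. f y \<omega> \<partial>walk_space N inc)"
      unfolding f_def using pred_hit_in[where N=N and inc=inc and s=s and T=T and z=y]
      by (subst nn_integral_indicator) (simp_all add: pred_def)
    also have "\<dots> = (\<integral>\<^sup>+xs. \<integral>\<^sup>+ds. f y (xs, ds) \<partial>?D \<partial>?X)"
      by (rule D.nn_integral_fst[symmetric]) (rule f)
    finally show ?thesis .
  qed
  have split: "f z (x ## xs, d ## ds) = (if z \<le> int (s ! x) then indicator T x else f (z + d) (xs, ds))"
    for x xs d ds
    by (auto simp: f_def hit_in_SCons indicator_def)
  have inner: "(\<lambda>xs. \<integral>\<^sup>+ds. f y (xs, ds) \<partial>?D) \<in> borel_measurable ?X" for y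
    by measurable
  \<comment> \<open>Splitting both streams leaves the tail of the columns outside the first
    increment. Exchanging the two integrals restores the walk space of the remaining path.\<close>
  have swap: "(\<integral>\<^sup>+xs. \<integral>\<^sup>+d. \<integral>\<^sup>+ds. f (z + d) (xs, ds) \<partial>?D \<partial>inc \<partial>?X) =
      (\<integral>\<^sup>+d. \<integral>\<^sup>+xs. \<integral>\<^sup>+ds. f (z + d) (xs, ds) \<partial>?D \<partial>?X \<partial>inc)"
  proof (rule Xi.Fubini'[symmetric])
    have "(\<lambda>\<omega>. \<integral>\<^sup>+ds. f (z + snd \<omega>) (fst \<omega>, ds) \<partial>?D) \<in> borel_measurable (?X \<Otimes>\<^sub>M measure_pmf inc)"
    proof (rule measurable_compose_countable[where g=snd])
      show "(\<lambda>\<omega>. \<integral>\<^sup>+ds. f (z + d) (fst \<omega>, ds) \<partial>?D) \<in> borel_measurable (?X \<Otimes>\<^sub>M measure_pmf inc)" for d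
        by (rule measurable_compose[OF measurable_fst inner])
      show "snd \<in> measurable (?X \<Otimes>\<^sub>M measure_pmf inc) (count_space UNIV)"
        using measurable_snd[of ?X "measure_pmf inc"] by (simp cong: measurable_cong_sets)
    qed
    then show "(\<lambda>(xs, d). \<integral>\<^sup>+ds. f (z + d) (xs, ds) \<partial>?D) \<in> borel_measurable (?X \<Otimes>\<^sub>M measure_pmf inc)"
      by (simp add: case_prod_unfold)
  qed
  have "emeasure (walk_space N inc) {\<omega>. hit_in s T z \<omega>} =
      (\<integral>\<^sup>+x. \<integral>\<^sup>+xs. \<integral>\<^sup>+ds. f z (x ## xs, ds) \<partial>?D \<partial>?X \<partial>?p)"
    unfolding em by (rule prob_space.nn_integral_stream_space[OF prob_space_measure_pmf]) (rule inner)
  also have "\<dots> = (\<integral>\<^sup>+x. \<integral>\<^sup>+xs. \<integral>\<^sup>+d. \<integral>\<^sup>+ds. f z (x ## xs, d ## ds) \<partial>?D \<partial>inc \<partial>?X \<partial>?p)"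
  proof (intro nn_integral_cong prob_space.nn_integral_stream_space[OF prob_space_measure_pmf])
    fix x xs
    have "Pair (x ## xs) \<in> measurable ?D (walk_space N inc)"
      by (rule measurable_Pair1') (simp add: space_stream_space streams_UNIV)
    then show "(\<lambda>ds. f z (x ## xs, ds)) \<in> borel_measurable ?D"
      by (rule measurable_compose) (rule f)
  qed
  also have "\<dots> = (\<integral>\<^sup>+x. (if z \<le> int (s ! x) then indicator T x
       else (\<integral>\<^sup>+d. emeasure (walk_space N inc) {\<omega>. hit_in s T (z + d) \<omega>} \<partial>inc)) \<partial>?p)"
    unfolding split em
    by (intro nn_integral_cong) (auto simp: swap X.emeasure_space_1 D.emeasure_space_1 measure_pmf.emeasure_space_1)
  finally show ?thesis .
qed

lemma sum_indicator_card: "S \<subseteq> {..<N::nat} \<Longrightarrow> (\<Sum>x<N. indicator S x) = real (card S)"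
  using sum.mono_neutral_cong_right[of "{..<N}" S "indicator S" "\<lambda>_. 1::real"] by simp

text \<open>This is the equation in \<open>monotone_green\<close>: \<open>k\<close> is the chance of
  stopping at once in \<open>T\<close>, \<open>d\<close> the chance of passing on.\<close>

lemma hit_prob_step:
  assumes N: "0 < N" and T: "T \<subseteq> {..<N}"
  shows "hit_prob N inc s T z = real (card {i\<in>T. z \<le> int (s ! i)}) / real N +
    (1 - real (card {i\<in>{..<N}. z \<le> int (s ! i)}) / real N) *
      measure_pmf.expectation inc (\<lambda>d. hit_prob N inc s T (z + d))"
proof -
  interpret W: prob_space "walk_space N inc" by (rule prob_space_walk_space)
  let ?E = "measure_pmf.expectation inc (\<lambda>d. hit_prob N inc s T (z + d))"
  let ?A = "{i\<in>{..<N}. z \<le> int (s ! i)}"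
  have E: "(\<integral>\<^sup>+d. emeasure (walk_space N inc) {\<omega>. hit_in s T (z + d) \<omega>} \<partial>inc) = ennreal ?E"
    unfolding W.emeasure_eq_measure hit_prob_def[symmetric]
    using hit_prob_bounds[of N inc s T]
    by (intro nn_integral_eq_integral measure_pmf.integrable_const_bound[where B=1]) auto
  have E0: "0 \<le> ?E"
    using hit_prob_bounds[of N inc s T] by (intro Bochner_Integration.integral_nonneg) auto
  have "ennreal (hit_prob N inc s T z) =
    (\<integral>\<^sup>+x. (if z \<le> int (s ! x) then indicator T x else ennreal ?E) \<partial>pmf_of_set {0..<N})"
    unfolding hit_prob_def W.emeasure_eq_measure[symmetric] emeasure_hit_in[of N inc s T z] E
    by (simp add: hit_prob_def)
  also have "\<dots> = (\<Sum>x\<in>{0..<N}. if z \<le> int (s ! x) then indicator T x else ennreal ?E) / of_nat N"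
    using N by (subst nn_integral_pmf_of_set) auto
  also have "\<dots> = ennreal ((\<Sum>x<N. if z \<le> int (s ! x) then indicator T x else ?E) / real N)"
  proof -
    have "(\<Sum>x\<in>{0..<N}. if z \<le> int (s ! x) then indicator T x else ennreal ?E) =
       (\<Sum>x<N. ennreal (if z \<le> int (s ! x) then indicator T x else ?E))"
      by (intro sum.cong) (auto simp: indicator_def)
    also have "\<dots> = ennreal (\<Sum>x<N. if z \<le> int (s ! x) then indicator T x else ?E)"
      using E0 by (intro sum_ennreal) auto
    finally show ?thesis
      using N E0 by (simp add: divide_ennreal ennreal_of_nat_eq_real_of_nat sum_nonneg)
  qed
  finally have "hit_prob N inc s T z = (\<Sum>x<N. if z \<le> int (s ! x) then indicator T x else ?E) / real N"
    using hit_prob_bounds[of N inc s T z] E0 N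
    by (subst (asm) ennreal_inj) (auto intro!: divide_nonneg_nonneg sum_nonneg)
  also have "(\<Sum>x<N. if z \<le> int (s ! x) then indicator T x else ?E) =
      real (card {i\<in>T. z \<le> int (s ! i)}) + (real N - real (card ?A)) * ?E"
  proof -
    have "(\<Sum>x<N. if z \<le> int (s ! x) then indicator T x else ?E) =
      (\<Sum>x<N. indicator {i\<in>T. z \<le> int (s ! i)} x + (?E - indicator ?A x * ?E))"
      by (intro sum.cong) (auto simp: indicator_def)
    also have "\<dots> = (\<Sum>x<N. indicator {i\<in>T. z \<le> int (s ! i)} x) + (real N * ?E - (\<Sum>x<N. indicator ?A x) * ?E)"
      by (simp add: sum.distrib sum_subtractf sum_distrib_right)
    also have "(\<Sum>x<N. indicator {i\<in>T. z \<le> int (s ! i)} x) = real (card {i\<in>T. z \<le> int (s ! i)})"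
      using T by (intro sum_indicator_card) auto
    also have "(\<Sum>x<N. indicator ?A x) = real (card ?A)"
      by (intro sum_indicator_card) auto
    finally show ?thesis by (simp add: algebra_simps)
  qed
  finally show ?thesis
    using N by (simp add: field_simps)
qed

text \<open>Follows from the first-step equation and the Green function. Scaling by \<open>N\<close>
  turns probabilities into column counts.\<close>

lemma hit_prob_top:
  assumes green: "monotone_green inc" and inc: "set_pmf inc \<subseteq> {-1..}"
    and s: "length s = N" "0 < N"
  defines "M \<equiv> Max (set s)"
  shows "\<exists>g c. mono g \<and> 0 < c \<and>
    (\<forall>T\<subseteq>{..<N}. c * hit_prob N inc s T (int M + 1) =
       (\<Sum>z\<le>M. g z * real (card {i\<in>T. z \<le> s ! i}))) \<and>
    c = (\<Sum>z\<le>M. g z * real (card {i\<in>{..<N}. z \<le> s ! i}))"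
proof -
  define a where "a z = real (card {i\<in>{..<N}. z \<le> s ! i}) / real N" for z
  define k where "k T z = real (card {i\<in>T. z \<le> s ! i}) / real N" for T z
  define d where "d z = 1 - a z" for z
  have a_k: "a z = k {..<N} z" for z
    by (simp add: a_def k_def)
  have le_M: "s ! i \<le> M" if "i < N" for i
    using that s by (simp add: M_def)
  have "mono d"
    unfolding d_def a_def
    by (intro monoI diff_left_mono divide_right_mono of_nat_mono card_mono) auto
  moreover have "d 0 = 0"
    using s by (simp add: d_def a_def)
  moreover have "\<forall>z. d z \<le> 1"
    by (simp add: d_def a_def)
  moreover have k_top: "k T z = 0" if "T \<subseteq> {..<N}" "M < z" for T z
  proof -
    have "{i\<in>T. z \<le> s ! i} = {}"
      using that le_M by fastforce
    then show ?thesis unfolding k_def by (simp only: card.empty of_nat_0 div_0)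
  qed
  then have "\<forall>z>M. d z = 1"
    by (simp add: d_def a_k)
  ultimately have "\<exists>g c. mono g \<and> c > 0 \<and>
      (\<forall>h k. (\<forall>z. 0 \<le> h z \<and> h z \<le> 1) \<longrightarrow> (\<forall>z>M. k z = 0) \<longrightarrow>
         (\<forall>z. h z = k z + d z * step_mean inc h z) \<longrightarrow> c * h (Suc M) = (\<Sum>z\<le>M. g z * k z))"
    by (rule green[unfolded monotone_green_def, THEN spec, THEN spec, THEN mp, THEN mp, THEN mp, THEN mp])
  then obtain g c where g: "mono g" "0 < c" and
    gc: "\<And>h k. (\<forall>z. 0 \<le> h z \<and> h z \<le> 1) \<Longrightarrow> (\<forall>z>M. k z = 0) \<Longrightarrow>
            (\<forall>z. h z = k z + d z * step_mean inc h z) \<Longrightarrow> c * h (Suc M) = (\<Sum>z\<le>M. g z * k z)"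
    by blast
  have hit: "c * hit_prob N inc s T (int M + 1) = (\<Sum>z\<le>M. g z * k T z)" if T: "T \<subseteq> {..<N}" for T
  proof -
    have "hit_prob N inc s T (int z) = k T z + d z * step_mean inc (\<lambda>z. hit_prob N inc s T (int z)) z" for z
    proof (cases z)
      case 0
      then show ?thesis
        using hit_prob_step[OF s(2) T, of inc s 0] s by (simp add: d_def a_def k_def)
    next
      case (Suc y)
      \<comment> \<open>From a positive height a step of at least -1 stays nonnegative, so
        \<open>nat\<close> does not truncate.\<close>
      have "step_mean inc (\<lambda>z. hit_prob N inc s T (int z)) z =
          measure_pmf.expectation inc (\<lambda>d. hit_prob N inc s T (int z + d))"
        unfolding step_mean_def
        by (rule integral_cong_AE) (use inc Suc in \<open>auto simp: AE_measure_pmf_iff\<close>)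
      then show ?thesis
        using hit_prob_step[OF s(2) T, of inc s "int z"] by (simp add: d_def a_def k_def)
    qed
    then have "c * hit_prob N inc s T (int (Suc M)) = (\<Sum>z\<le>M. g z * k T z)"
      using hit_prob_bounds[of N inc s T] k_top[OF T]
      by (intro gc[of "\<lambda>z. hit_prob N inc s T (int z)" "k T"]) blast+
    then show ?thesis by (simp add: add.commute)
  qed
  \<comment> \<open>The constant 1 solves the same equation as the hitting probability of all
    columns. Comparing the two values shows that the explorer stops almost surely.\<close>
  have full: "c * (\<lambda>_. 1) (Suc M) = (\<Sum>z\<le>M. g z * k {..<N} z)"
  proof (rule gc[of "\<lambda>_. 1" "k {..<N}"])
    show "\<forall>z. (1::real) = k {..<N} z + d z * step_mean inc (\<lambda>_. 1) z"
      by (simp add: step_mean_def d_def a_k)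
  qed (use k_top in auto)
  have scale: "(\<Sum>z\<le>M. g z * k T z) * real N = (\<Sum>z\<le>M. g z * real (card {i\<in>T. z \<le> s ! i}))" for T
    using s(2) by (simp add: k_def sum_distrib_right)
  show ?thesis
  proof (intro exI[of _ g] exI[of _ "c * real N"] conjI allI impI)
    show "c * real N * hit_prob N inc s T (int M + 1) = (\<Sum>z\<le>M. g z * real (card {i\<in>T. z \<le> s ! i}))"
      if "T \<subseteq> {..<N}" for T
      unfolding scale[symmetric] hit[OF that, symmetric] by simp
    show "c * real N = (\<Sum>z\<le>M. g z * real (card {i\<in>{..<N}. z \<le> s ! i}))"
      unfolding scale[symmetric] full[symmetric] by simp
  qed (use g s in simp_all)
qed

section \<open>Deposition\<close>

text \<open>Countably many null singletons form a null set, so almost every point carries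
  mass.\<close>

lemma discrete_prob_space_pmf:
  fixes M :: "'a::countable measure"
  assumes "prob_space M" and sets: "sets M = UNIV"
  shows "\<exists>p. M = measure_pmf p"
proof -
  interpret prob_space M by fact
  have "AE y in M. \<forall>x. measure M {x} = 0 \<longrightarrow> y \<noteq> x"
    unfolding AE_all_countable
  proof
    fix x
    show "AE y in M. measure M {x} = 0 \<longrightarrow> y \<noteq> x"
    proof (cases "measure M {x} = 0")
      case True
      then have "{x} \<in> null_sets M"
        using sets by (auto simp: emeasure_eq_measure)
      from AE_not_in[OF this] show ?thesis by simp
    qed simp
  qed
  then have "AE y in M. measure M {y} \<noteq> 0"
    by eventually_elim blast
  then have "measure_pmf (Abs_pmf M) = M"
    using assms by (intro Abs_pmf_inverse) simp
  then show ?thesis by metis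
qed

text \<open>Counts pairs of a column and a level it reaches. Level 0 adds the 1 in the weights of
  Polya's urn.\<close>

lemma sum_level_sets:
  fixes s :: "nat list"
  assumes "finite T" "\<And>i. i \<in> T \<Longrightarrow> s ! i \<le> M"
  shows "(\<Sum>z\<le>M. card {i\<in>T. z \<le> s ! i}) = (\<Sum>i\<in>T. s ! i + 1)"
proof -
  have "(\<Sum>z\<le>M. card {i\<in>T. z \<le> s ! i}) = (\<Sum>i\<in>T. card {z\<in>{..M}. z \<le> s ! i})"
    by (rule sum_multicount_gen) (use assms in auto)
  also have "\<dots> = (\<Sum>i\<in>T. s ! i + 1)"
  proof (rule sum.cong[OF refl])
    fix i assume "i \<in> T"
    then have "{z\<in>{..M}. z \<le> s ! i} = {..s ! i}"
      using assms(2)[of i] by auto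
    then show "card {z\<in>{..M}. z \<le> s ! i} = s ! i + 1" by simp
  qed
  finally show ?thesis .
qed

text \<open>Given the height of the hit, the column is uniform among those reaching it, so the conditional
  probability of a top column is nondecreasing in that height.\<close>

lemma top_columns_level_ratio:
  assumes "y \<le> z" "k \<le> length s"
  defines "A \<equiv> \<lambda>z. {i\<in>{..<length s}. z \<le> s ! i}" and "B \<equiv> \<lambda>z. {i\<in>top_columns k s. z \<le> s ! i}"
  shows "card (B y) * card (A z) \<le> card (B z) * card (A y)"
proof -
  have BA: "B w \<subseteq> A w" for w
    using top_columns_subset by (auto simp: A_def B_def)
  have AA: "A z \<subseteq> A y" and BB: "B z \<subseteq> B y"
    using assms(1) by (auto simp: A_def B_def)
  have fin: "finite (A w)" "finite (B w)" for w
    by (auto simp: A_def B_def)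
  \<comment> \<open>If some top column misses \<open>z\<close>, every column reaching
    \<open>z\<close> is a top column. Otherwise all top columns reach \<open>z\<close>, and hence
    \<open>y\<close>.\<close>
  consider "A z \<subseteq> B z" | "top_columns k s \<subseteq> A z"
  proof (cases "top_columns k s \<subseteq> A z")
    case False
    then obtain i where i: "i \<in> top_columns k s" "i \<notin> A z"
      by blast
    then have "s ! i < z"
      using top_columns_subset[of k s] by (auto simp: A_def)
    have "A z \<subseteq> B z"
      using top_columns_le[OF i(1)] \<open>s ! i < z\<close> by (force simp: A_def B_def)
    then show ?thesis using that by blast
  qed (use that in blast)
  then show ?thesis
  proof cases
    case 1
    then have "A z = B z" using BA by blast
    then show ?thesis
      using card_mono[OF fin(1) BA[of y]] by (simp add: mult.commute)
  next
    case 2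
    then have "B z = B y"
      using assms(1) by (auto simp: A_def B_def)
    then show ?thesis
      using card_mono[OF fin(1) AA] by simp
  qed
qed

lemma explorer_result_hits:
  "explorer_result s xs ds = (if \<exists>n. hits s (int (Max (set s)) + 1) xs ds n
     then incr s (xs !! (LEAST n. hits s (int (Max (set s)) + 1) xs ds n)) else s)"
  by (simp add: explorer_result_def hits_def)

lemma measurable_explorer_result:
  "(\<lambda>\<omega>. explorer_result s (fst \<omega>) (snd \<omega>)) \<in> measurable (walk_space N inc) (count_space UNIV)"
  unfolding explorer_result_hits
  by (intro measurable_If measurable_compose[OF measurable_hit_column]) measurable

text \<open>Compares deposition with the urn at the same configuration; \<open>p\<close> is the law
  of the column where the explorer stops.\<close>

lemma deposition_column:
  assumes green: "monotone_green inc" and inc: "set_pmf inc \<subseteq> {-1..}"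
    and s: "length s = N" "0 < N"
  obtains p where "deposition_step N inc s = measure_pmf (map_pmf (incr s) p)"
    "set_pmf p \<subseteq> {..<N}"
    "\<And>k. k \<le> N \<Longrightarrow> measure (polya_column N s) (top_columns k s) \<le> measure p (top_columns k s)"
proof -
  interpret W: prob_space "walk_space N inc" by (rule prob_space_walk_space)
  define M where "M = Max (set s)"
  define z where "z = int M + 1"
  \<comment> \<open>On paths that never stop the value is arbitrary; they have probability
    0.\<close>
  define I where "I \<omega> = fst \<omega> !! (LEAST n. hits s z (fst \<omega>) (snd \<omega>) n)" for \<omega>
  have I[measurable]: "I \<in> measurable (walk_space N inc) (count_space UNIV)"
    unfolding I_def by (rule measurable_hit_column)
  have le_M: "s ! i \<le> M" if "i < N" for i
    using that s by (simp add: M_def)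
  obtain g c where g: "mono g" "0 < c" and
    hp: "\<And>T. T \<subseteq> {..<N} \<Longrightarrow> c * hit_prob N inc s T z = (\<Sum>z\<le>M. g z * real (card {i\<in>T. z \<le> s ! i}))"
    and c: "c = (\<Sum>z\<le>M. g z * real (card {i\<in>{..<N}. z \<le> s ! i}))"
    using hit_prob_top[OF green inc s] unfolding M_def z_def by blast
  have "hit_prob N inc s {..<N} z = 1"
    using hp[OF subset_refl] c g(2) by simp
  then have AE_hit: "AE \<omega> in walk_space N inc. hit_in s {..<N} z \<omega>"
    unfolding hit_prob_def using pred_hit_in[where N=N and inc=inc and s=s and T="{..<N}" and z=z]
    by (subst (asm) W.prob_eq_1) (simp_all add: pred_def)
  have "prob_space (distr (walk_space N inc) (count_space UNIV) I)"
    by (rule W.prob_space_distr) (rule I)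
  then obtain p where p: "distr (walk_space N inc) (count_space UNIV) I = measure_pmf p"
    using discrete_prob_space_pmf by fastforce
  have p_hit: "measure p T = hit_prob N inc s T z" if "T \<subseteq> {..<N}" for T
  proof -
    have "measure p T = measure (walk_space N inc) {\<omega>. I \<omega> \<in> T}"
      unfolding p[symmetric] by (subst measure_distr) (auto simp: vimage_def)
    also have "\<dots> = hit_prob N inc s T z"
      unfolding hit_prob_def
    proof (rule W.finite_measure_eq_AE)
      show "AE \<omega> in walk_space N inc. (\<omega> \<in> {\<omega>. I \<omega> \<in> T}) = (\<omega> \<in> {\<omega>. hit_in s T z \<omega>})"
        using AE_hit by eventually_elim (auto simp: hit_in_def I_def)
      show "{\<omega>. I \<omega> \<in> T} \<in> sets (walk_space N inc)"
        using measurable_sets[OF I, of T] by (simp add: vimage_def)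
      show "{\<omega>. hit_in s T z \<omega>} \<in> sets (walk_space N inc)"
        using pred_hit_in[where N=N and inc=inc and s=s and T=T and z=z] by (simp add: pred_def)
    qed
    finally show ?thesis .
  qed
  have supp: "set_pmf p \<subseteq> {..<N}"
    using p_hit[OF subset_refl] \<open>hit_prob N inc s {..<N} z = 1\<close>
    by (simp add: measure_pmf.prob_eq_1 AE_measure_pmf_iff subset_eq)
  have step: "deposition_step N inc s = measure_pmf (map_pmf (incr s) p)"
  proof -
    have incr_I: "(\<lambda>\<omega>. incr s (I \<omega>)) \<in> measurable (walk_space N inc) (count_space UNIV)"
      by (rule measurable_compose[OF I]) simp
    have "deposition_step N inc s =
        distr (walk_space N inc) (count_space UNIV) (\<lambda>\<omega>. explorer_result s (fst \<omega>) (snd \<omega>))"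
      by (simp add: deposition_step_def case_prod_unfold)
    also have "\<dots> = distr (walk_space N inc) (count_space UNIV) (\<lambda>\<omega>. incr s (I \<omega>))"
    proof (rule distr_cong_AE)
      show "AE \<omega> in walk_space N inc. explorer_result s (fst \<omega>) (snd \<omega>) = incr s (I \<omega>)"
        using AE_hit
        by eventually_elim (auto simp: hit_in_def explorer_result_hits I_def z_def M_def)
    qed (use incr_I measurable_explorer_result in auto)
    also have "\<dots> = measure_pmf (map_pmf (incr s) p)"
      unfolding map_pmf_rep_eq p[symmetric] by (subst distr_distr) (auto simp: o_def)
    finally show ?thesis .
  qed
  have "measure (polya_column N s) (top_columns k s) \<le> measure p (top_columns k s)" if k: "k \<le> N" for k
  proof -
    let ?T = "top_columns k s" and ?h = "hit_prob N inc s (top_columns k s) z"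
    let ?k = "\<lambda>z. real (card {i\<in>top_columns k s. z \<le> s ! i})"
    let ?a = "\<lambda>z. real (card {i\<in>{..<N}. z \<le> s ! i})"
    have T: "?T \<subseteq> {..<N}"
      using top_columns_subset[of k s] s by simp
    \<comment> \<open>Chebyshev's inequality with \<open>c\<close> written as the
      \<open>g\<close>-weighted sum over all columns. Unweighted sums over levels give the urn's
      probabilities.\<close>
    have "(\<Sum>z\<le>M. ?k z) * c \<le> (c * ?h) * (\<Sum>z\<le>M. ?a z)"
      unfolding hp[OF T] by (subst c, rule chebyshev_weighted[OF g(1)])
        (use top_columns_level_ratio[of _ _ k s] k s in \<open>simp flip: of_nat_mult\<close>)
    then have le: "(\<Sum>z\<le>M. ?k z) \<le> ?h * (\<Sum>z\<le>M. ?a z)"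
      using g(2) by (simp add: mult.commute mult.left_commute)
    have "(\<Sum>z\<le>M. ?k z) = real (\<Sum>i\<in>?T. s ! i + 1)"
      unfolding of_nat_sum[symmetric] using T le_M by (subst sum_level_sets) auto
    moreover have "(\<Sum>z\<le>M. ?a z) = real (sum_list s + N)"
    proof -
      have "(\<Sum>z\<le>M. ?a z) = real (\<Sum>i<N. s ! i + 1)"
        unfolding of_nat_sum[symmetric] using le_M by (subst sum_level_sets) auto
      then show ?thesis
        using s by (simp add: sum_list_sum_nth lessThan_atLeast0 sum_Suc)
    qed
    ultimately have "real (\<Sum>i\<in>?T. s ! i + 1) \<le> ?h * real (sum_list s + N)"
      using le by simp
    then show ?thesis
      unfolding measure_polya_column[OF s T] p_hit[OF T]
      using s(2) by (subst pos_divide_le_eq) simp_all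
  qed
  with step supp show ?thesis by (rule that)
qed

lemma deposition_dominates_polya:
  assumes green: "monotone_green inc" and inc: "set_pmf inc \<subseteq> {-1..}" and N: "0 < N"
  shows "coupling_dominates (deposition_step N inc) (replicate N 0) (polya_step N) (replicate N 0)"
proof -
  \<comment> \<open>The coupling criterion takes a \<open>pmf\<close> kernel on all lists, of
    whatever length.\<close>
  have "\<exists>k. deposition_step N inc s = measure_pmf k" for s
  proof (rule discrete_prob_space_pmf)
    interpret W: prob_space "walk_space N inc" by (rule prob_space_walk_space)
    show "prob_space (deposition_step N inc s)"
      unfolding deposition_step_def by (intro W.prob_space_distr)
        (simp add: case_prod_unfold measurable_explorer_result)
  qed (simp add: deposition_step_def)
  then obtain k where k: "\<And>s. deposition_step N inc s = measure_pmf (k s)"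
    by metis
  have "\<exists>p. k s = map_pmf (incr s) p \<and> set_pmf p \<subseteq> {..<N} \<and>
      (\<forall>j\<le>N. measure (polya_column N s) (top_columns j s) \<le> measure p (top_columns j s))"
    if "length s = N" for s
    using deposition_column[OF green inc that N] unfolding k measure_pmf_inject by metis
  then obtain p where p: "\<And>s. length s = N \<Longrightarrow> k s = map_pmf (incr s) (p s)"
      "\<And>s. length s = N \<Longrightarrow> set_pmf (p s) \<subseteq> {..<N}"
      "\<And>s j. length s = N \<Longrightarrow> j \<le> N \<Longrightarrow>
        measure (polya_column N s) (top_columns j s) \<le> measure (p s) (top_columns j s)"
    by metis
  have "coupling_dominates (\<lambda>s. measure_pmf (k s)) (replicate N 0)
    (\<lambda>s. measure_pmf (map_pmf (incr s) (polya_column N s))) (replicate N 0)"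
  proof (rule coupling_dominates_incr[OF N p(1) refl p(2)])
    show "measure (polya_column N e) (top_columns j e) \<le> measure (p s) (top_columns j s)"
      if "length s = N" "dominates s e" "j \<le> N" for s e j
      \<comment> \<open>The urn at \<open>s\<close> lies in between: it exceeds the urn at
        \<open>e\<close>, and deposition at \<open>s\<close> exceeds it.\<close>
      using polya_column_mono[OF that(1) N that(2,3)] p(3)[OF that(1,3)] by (rule order_trans)
  qed (use N set_polya_column in auto)
  moreover have "deposition_step N inc = (\<lambda>s. measure_pmf (k s))"
    using k by (rule ext)
  ultimately show ?thesis
    by (simp add: polya_step_def[abs_def] polya_column_def)
qed

theorem theorem1p3:
  fixes N :: nat
  assumes "N \<ge> 2"
  shows "coupling_dominates (diffusive_step N) (replicate N 0) (polya_step N) (replicate N 0)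
       \<and> coupling_dominates (ballistic_step N) (replicate N 0) (polya_step N) (replicate N 0)
       \<and> coupling_dominates (polya_step N) (replicate N 0) (allocation_step N) (replicate N 0)"
proof (intro conjI)
  have N: "0 < N" using assms by simp
  show "coupling_dominates (diffusive_step N) (replicate N 0) (polya_step N) (replicate N 0)"
    unfolding diffusive_step_def
    by (rule deposition_dominates_polya[OF monotone_green_diffusive _ N]) simp
  show "coupling_dominates (ballistic_step N) (replicate N 0) (polya_step N) (replicate N 0)"
    unfolding ballistic_step_def
    by (rule deposition_dominates_polya[OF monotone_green_ballistic _ N]) simp
  show "coupling_dominates (polya_step N) (replicate N 0) (allocation_step N) (replicate N 0)"
    by (rule polya_dominates_allocation[OF N])
qed

end
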